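(* Let $\{N_t\}$ be a holomorphic family of degree $d=2$ Newton maps such that $N_t$ converges, as $t\to0$, to the point in $I(2)$. Let $\mu$ be the weak limit, as $t\to0$, of the maximal measures $\mu_t$ of $N_t$. Then $\mu=\delta_\infty$.
   Context: A point $f\in\mathbb{P}^{2d+1}$ is identified with a pair $[F_a(X,Y):F_b(X,Y)]$ of homogeneous degree $d$ polynomials over $\mathbb{C}$ (not both zero, up to common scaling); write $f=H_f\hat f$ with $H_f=\gcd(F_a,F_b)$ and $\hat f=[F_a/H_f:F_b/H_f]$. $\mathrm{Rat}_d$ is the set of $f$ with $\deg\hat f=d$. $I(d)$ is the set of $f=H_f\hat f$ with $\hat f\equiv h$ constant and $H_f(h)=0$. A Newton map of degree $d$ is $N_P(z)=z-P(z)/P'(z)$ where $P$ is a monic degree $d$ complex polynomial with $d$ distinct roots. The closure of the set of degree $d$ Newton maps meets $I(d)$ in a single point, $[Y^d:0]$. A holomorphic family of degree $d$ Newton maps is a holomorphic map $\mathbb{D}\to\mathbb{P}^{2d+1}$, $t\mapsto N_t$, with $N_t$ a degree $d$ Newton map for $t\neq0$. The maximal measure of a rational map of degree at least $2$ is its unique measure of maximal entropy on $\mathbb{P}^1(\mathbb{C})$; the weak limit $\mu$ is known to exist (DeMarco–Faber). $\delta_\infty$ is the Dirac mass at $\infty$. *)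

theory Defs
  imports
    "HOL-Analysis.Analysis"
    "HOL-Probability.Probability"
    "HOL-Computational_Algebra.Computational_Algebra"
    "HOL-Computational_Algebra.Field_as_Ring"
begin

definition line_rel :: "complex \<times> complex \<Rightarrow> complex \<times> complex \<Rightarrow> bool" where
  "line_rel v w \<longleftrightarrow> v \<noteq> 0 \<and> w \<noteq> 0 \<and> (\<exists>c. c \<noteq> 0 \<and> w = (c * fst v, c * snd v))"

lemma line_rel_sym: "line_rel v w \<Longrightarrow> line_rel w v"
proof -
  assume a: "line_rel v w"
  then obtain c where c: "c \<noteq> 0" "w = (c * fst v, c * snd v)" "v \<noteq> 0" "w \<noteq> 0"
    unfolding line_rel_def by blast
  then have "inverse c \<noteq> 0 \<and> v = (inverse c * fst w, inverse c * snd w)"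
    by (auto simp: prod_eq_iff)
  with c show "line_rel w v" unfolding line_rel_def by blast
qed

lemma line_rel_trans: "line_rel u v \<Longrightarrow> line_rel v w \<Longrightarrow> line_rel u w"
proof -
  assume "line_rel u v" "line_rel v w"
  then obtain c e where c: "c \<noteq> 0" "v = (c * fst u, c * snd u)" "u \<noteq> 0"
    and e: "e \<noteq> 0" "w = (e * fst v, e * snd v)" "w \<noteq> 0"
    unfolding line_rel_def by blast
  then have "e * c \<noteq> 0 \<and> w = (e * c * fst u, e * c * snd u)" by auto
  with c e show "line_rel u w" unfolding line_rel_def by blast
qed

quotient_type cp1 = "complex \<times> complex" / partial: line_rel
proof (rule part_equivpI)
  show "\<exists>x. line_rel x x"
    by (rule exI[of _ "(1, 0)"]) (auto simp: line_rel_def zero_prod_def intro: exI[of _ 1])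
  show "symp line_rel" using line_rel_sym by (auto simp: symp_def)
  show "transp line_rel" using line_rel_trans by (auto simp: transp_def)
qed

definition cp1_pt :: "complex \<Rightarrow> complex \<Rightarrow> cp1" where
  "cp1_pt x y = abs_cp1 (x, y)"

definition cp1_infinity :: cp1 where
  "cp1_infinity = cp1_pt 1 0"

text \<open>The topology is the quotient topology from the punctured plane.\<close>

instantiation cp1 :: topological_space
begin

definition open_cp1 :: "cp1 set \<Rightarrow> bool" where
  "open_cp1 U \<longleftrightarrow> open {v. v \<noteq> 0 \<and> abs_cp1 v \<in> U}"

instance
proof
  show "open (UNIV :: cp1 set)"
    by (simp add: open_cp1_def open_Collect_neq)
next
  fix S T :: "cp1 set"
  assume "open S" "open T"
  then have "open ({v. v \<noteq> 0 \<and> abs_cp1 v \<in> S} \<inter> {v. v \<noteq> 0 \<and> abs_cp1 v \<in> T})"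
    unfolding open_cp1_def by (rule open_Int)
  then show "open (S \<inter> T)"
    unfolding open_cp1_def by (rule back_subst[where P = "open"]) auto
next
  fix K :: "cp1 set set"
  assume "\<forall>S\<in>K. open S"
  then have "open (\<Union>S\<in>K. {v. v \<noteq> 0 \<and> abs_cp1 v \<in> S})"
    unfolding open_cp1_def by (intro open_UN)
  then show "open (\<Union>K)"
    unfolding open_cp1_def by (rule back_subst[where P = "open"]) auto
qed

end

lemma line_rel_refl: "v \<noteq> 0 \<Longrightarrow> line_rel v v"
  by (auto simp: line_rel_def intro!: exI[of _ 1])

lemma cp1_pt_eq_iff:
  assumes "(x, y) \<noteq> 0" "(x', y') \<noteq> 0"
  shows "cp1_pt x y = cp1_pt x' y' \<longleftrightarrow> (\<exists>c. c \<noteq> 0 \<and> x' = c * x \<and> y' = c * y)"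
  using Quotient3_rel[OF Quotient3_cp1, of "(x, y)" "(x', y')"] assms
  by (auto simp: cp1_pt_def line_rel_refl) (auto simp: line_rel_def)

lemma rep_cp1_nonzero: "rep_cp1 z \<noteq> 0"
  using Quotient3_rep_reflp[OF Quotient3_cp1, of z] by (auto simp: line_rel_def)

lemma cp1_pt_rep: "cp1_pt (fst (rep_cp1 z)) (snd (rep_cp1 z)) = z"
  using Quotient3_abs_rep[OF Quotient3_cp1, of z] by (simp add: cp1_pt_def)

text \<open>
  A binary form of degree \<open>d\<close> over the complex numbers is encoded by its dehomogenisation,
  a univariate polynomial \<open>p\<close> with \<open>degree p \<le> d\<close>: the form is
  \<open>F(X, Y) = (\<Sum>i\<le>d. coeff p i * X^i * Y^(d - i))\<close>. The degree of the form has to be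
  remembered separately, since \<open>p\<close> does not see the factors \<open>Y\<close> of \<open>F\<close>.
\<close>

definition form_eval :: "nat \<Rightarrow> complex poly \<Rightarrow> complex \<Rightarrow> complex \<Rightarrow> complex" where
  "form_eval d p x y = (\<Sum>i\<le>d. coeff p i * x ^ i * y ^ (d - i))"

type_synonym form_pair = "complex poly \<times> complex poly"

definition form_pairs :: "nat \<Rightarrow> form_pair set" where
  "form_pairs d = {F. degree (fst F) \<le> d \<and> degree (snd F) \<le> d \<and> F \<noteq> (0, 0)}"

definition proj_class :: "form_pair \<Rightarrow> form_pair set" where
  "proj_class F = {(smult c (fst F), smult c (snd F)) | c. c \<noteq> 0}"

text \<open>\<open>proj_space d\<close> is the complex projective space of dimension \<open>2 * d + 1\<close>.\<close>

definition proj_space :: "nat \<Rightarrow> form_pair set set" where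
  "proj_space d = proj_class ` form_pairs d"

definition form_pairs_topology :: "nat \<Rightarrow> form_pair topology" where
  "form_pairs_topology d =
     pullback_topology (form_pairs d) (\<lambda>F. (coeff (fst F), coeff (snd F))) euclidean"

definition proj_topology :: "nat \<Rightarrow> form_pair set topology" where
  "proj_topology d = topology (\<lambda>U. U \<subseteq> proj_space d \<and>
     openin (form_pairs_topology d) {F \<in> form_pairs d. proj_class F \<in> U})"

lemma topspace_form_pairs_topology: "topspace (form_pairs_topology d) = form_pairs d"
  by (simp add: form_pairs_topology_def topspace_pullback_topology)

lemma openin_proj_topology:
  "openin (proj_topology d) U \<longleftrightarrow> U \<subseteq> proj_space d \<and>
     openin (form_pairs_topology d) {F \<in> form_pairs d. proj_class F \<in> U}"
proof -
  let ?P = "\<lambda>U. {F \<in> form_pairs d. proj_class F \<in> U}"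
  have "istopology (\<lambda>U. U \<subseteq> proj_space d \<and> openin (form_pairs_topology d) (?P U))"
    unfolding istopology_def
  proof (intro conjI allI impI)
    fix S T
    assume S: "S \<subseteq> proj_space d \<and> openin (form_pairs_topology d) (?P S)"
      and T: "T \<subseteq> proj_space d \<and> openin (form_pairs_topology d) (?P T)"
    show "S \<inter> T \<subseteq> proj_space d" using S by blast
    have "openin (form_pairs_topology d) (?P S \<inter> ?P T)" using S T by blast
    moreover have "?P S \<inter> ?P T = ?P (S \<inter> T)" by blast
    ultimately show "openin (form_pairs_topology d) (?P (S \<inter> T))" by simp
  next
    fix K
    assume K: "\<forall>S\<in>K. S \<subseteq> proj_space d \<and> openin (form_pairs_topology d) (?P S)"
    show "\<Union>K \<subseteq> proj_space d" using K by blast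
    have "openin (form_pairs_topology d) (\<Union>S\<in>K. ?P S)" using K by blast
    moreover have "(\<Union>S\<in>K. ?P S) = ?P (\<Union>K)" by blast
    ultimately show "openin (form_pairs_topology d) (?P (\<Union>K))" by simp
  qed
  then show ?thesis unfolding proj_topology_def by (simp add: topology_inverse')
qed

lemma topspace_proj_topology: "topspace (proj_topology d) = proj_space d"
proof
  show "topspace (proj_topology d) \<subseteq> proj_space d"
    using openin_topspace[of "proj_topology d"] unfolding openin_proj_topology by blast
  have "{F \<in> form_pairs d. proj_class F \<in> proj_space d} = topspace (form_pairs_topology d)"
    by (auto simp: topspace_form_pairs_topology proj_space_def)
  then have "openin (proj_topology d) (proj_space d)"
    by (simp add: openin_proj_topology)
  then show "proj_space d \<subseteq> topspace (proj_topology d)" by (rule openin_subset)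
qed

text \<open>
  The factorisation of a pair of forms into the gcd and the reduced pair. A reduced pair is not
  divisible by \<open>Y\<close>, so its degree as a pair of forms is the maximum of the polynomial degrees.
  For a pair of forms of degree \<open>d\<close>, the gcd form has degree \<open>d - hat_degree F\<close>, and
  \<open>gcd_part F\<close> is its dehomogenisation: powers of \<open>Y\<close> in the gcd are carried by the degree.
\<close>

definition gcd_part :: "form_pair \<Rightarrow> complex poly" where
  "gcd_part F = gcd (fst F) (snd F)"

definition hat_pair :: "form_pair \<Rightarrow> form_pair" where
  "hat_pair F = (fst F div gcd_part F, snd F div gcd_part F)"

definition hat_degree :: "form_pair \<Rightarrow> nat" where
  "hat_degree F = max (degree (fst (hat_pair F))) (degree (snd (hat_pair F)))"

definition rat_map :: "form_pair set \<Rightarrow> cp1 \<Rightarrow> cp1" where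
  "rat_map f z =
     (let F = (SOME F. F \<in> f); (x, y) = rep_cp1 z; e = hat_degree F
      in cp1_pt (form_eval e (fst (hat_pair F)) x y) (form_eval e (snd (hat_pair F)) x y))"

text \<open>
  The indeterminacy locus: the reduced pair is a constant \<open>h = [a : b]\<close>, and the gcd, here a
  form of full degree \<open>d\<close>, vanishes at \<open>h\<close>.
\<close>

definition indet_locus :: "nat \<Rightarrow> form_pair set set" where
  "indet_locus d = {proj_class F | F. F \<in> form_pairs d \<and>
     (\<exists>a b. hat_pair F = ([:a:], [:b:]) \<and> form_eval d (gcd_part F) a b = 0)}"

lemma form_eval_scale: "form_eval d p (c * x) (c * y) = c ^ d * form_eval d p x y"
proof -
  have "coeff p i * (c * x) ^ i * (c * y) ^ (d - i) =
      c ^ d * (coeff p i * x ^ i * y ^ (d - i))" if "i \<le> d" for i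
  proof -
    have "c ^ d = c ^ i * c ^ (d - i)" using that by (simp flip: power_add)
    then show ?thesis by (simp add: power_mult_distrib)
  qed
  then show ?thesis unfolding form_eval_def sum_distrib_left by (intro sum.cong) auto
qed

lemma form_eval_smult: "form_eval d (smult c p) x y = c * form_eval d p x y"
  by (simp add: form_eval_def sum_distrib_left mult.assoc)

lemma form_eval_poly:
  assumes "degree p \<le> d"
  shows "form_eval d p x 1 = poly p x"
proof -
  have "poly p x = (\<Sum>i\<le>d. coeff p i * x ^ i)"
    unfolding poly_altdef
    by (rule sum.mono_neutral_left) (use assms in \<open>auto simp: coeff_eq_0\<close>)
  then show ?thesis by (simp add: form_eval_def)
qed

lemma form_eval_infinity: "form_eval d p x 0 = coeff p d * x ^ d"
proof -
  have "form_eval d p x 0 = (\<Sum>i\<le>d. if i = d then coeff p d * x ^ d else 0)"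
    unfolding form_eval_def by (rule sum.cong) auto
  then show ?thesis by simp
qed

lemma hat_pair_no_common_zero:
  assumes F: "F \<noteq> (0, 0)" and xy: "(x, y) \<noteq> 0"
  shows "(form_eval (hat_degree F) (fst (hat_pair F)) x y,
          form_eval (hat_degree F) (snd (hat_pair F)) x y) \<noteq> 0"
proof
  define a b e where "a = fst (hat_pair F)" and "b = snd (hat_pair F)" and "e = hat_degree F"
  assume "(form_eval (hat_degree F) (fst (hat_pair F)) x y,
          form_eval (hat_degree F) (snd (hat_pair F)) x y) = 0"
  then have ev: "form_eval e a x y = 0" "form_eval e b x y = 0"
    by (simp_all add: a_def b_def e_def zero_prod_def)
  have e: "e = max (degree a) (degree b)"
    by (simp add: a_def b_def e_def hat_degree_def)
  have "fst F \<noteq> 0 \<or> snd F \<noteq> 0" using F by (cases F) auto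
  then have cop: "coprime a b"
    unfolding a_def b_def hat_pair_def gcd_part_def by (auto intro: div_gcd_coprime)
  show False
  proof (cases "y = 0")
    case False
    have "form_eval e p x y = y ^ e * form_eval e p (x / y) 1" for p
      using form_eval_scale[of e p y "x / y" 1] False by simp
    then have "poly a (x / y) = 0" "poly b (x / y) = 0"
      using ev False form_eval_poly[of a e "x / y"] form_eval_poly[of b e "x / y"]
      by (simp_all add: e)
    then have "[:- (x / y), 1:] dvd a" "[:- (x / y), 1:] dvd b"
      by (simp_all only: poly_eq_0_iff_dvd)
    then have "is_unit [:- (x / y), 1:]" using cop coprime_common_divisor by blast
    then show False by (simp add: is_unit_pCons_iff)
  next
    case True
    then have "x \<noteq> 0" using xy by (simp add: zero_prod_def)
    then have "coeff a e = 0" "coeff b e = 0"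
      using ev True by (auto simp: form_eval_infinity)
    then have "a = 0 \<and> e = degree a \<or> b = 0 \<and> e = degree b"
      unfolding e by (auto simp: max_def split: if_splits)
    then have "a = 0 \<and> b = 0"
      using \<open>coeff a e = 0\<close> \<open>coeff b e = 0\<close> e leading_coeff_0_iff
      by (metis degree_0 max_0L max_nat.right_neutral)
    with cop show False by simp
  qed
qed

lemma hat_pair_smult:
  assumes "c \<noteq> 0"
  shows "hat_pair (smult c p, smult c q) =
    (smult c (fst (hat_pair (p, q))), smult c (snd (hat_pair (p, q))))"
proof -
  have "gcd (smult c p) (smult c q) = gcd ([:c:] * p) ([:c:] * q)" by simp
  also have "\<dots> = normalize ([:c:] * gcd p q)" by (simp only: gcd_mult_left)
  also have "\<dots> = gcd p q"
    using assms by (simp only: normalize_mult) (simp add: is_unit_normalize is_unit_pCons_iff)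
  finally show ?thesis by (simp add: hat_pair_def gcd_part_def div_smult_left)
qed

lemma rat_map_proj_class:
  assumes F: "F \<in> form_pairs d" and xy: "(x, y) \<noteq> 0"
  shows "rat_map (proj_class F) (cp1_pt x y) =
    cp1_pt (form_eval (hat_degree F) (fst (hat_pair F)) x y)
           (form_eval (hat_degree F) (snd (hat_pair F)) x y)"
proof -
  define G where "G = (SOME G. G \<in> proj_class F)"
  have "F \<in> proj_class F" by (auto simp: proj_class_def intro!: exI[of _ 1])
  then have "G \<in> proj_class F" unfolding G_def by (rule someI)
  then obtain c where c: "c \<noteq> 0" "G = (smult c (fst F), smult c (snd F))"
    by (auto simp: proj_class_def)
  then have G: "hat_pair G = (smult c (fst (hat_pair F)), smult c (snd (hat_pair F)))"
    by (simp add: hat_pair_smult)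
  then have e: "hat_degree G = hat_degree F" using c by (simp add: hat_degree_def)
  obtain x' y' where x'y': "rep_cp1 (cp1_pt x y) = (x', y')" by fastforce
  then have nz: "(x', y') \<noteq> 0" using rep_cp1_nonzero[of "cp1_pt x y"] by simp
  have "cp1_pt x y = cp1_pt x' y'" using cp1_pt_rep[of "cp1_pt x y"] x'y' by simp
  then obtain k where k: "k \<noteq> 0" "x' = k * x" "y' = k * y"
    using cp1_pt_eq_iff[OF xy nz] by blast
  have F0: "F \<noteq> (0, 0)" using F by (simp add: form_pairs_def)
  let ?e = "hat_degree F"
  let ?A = "form_eval ?e (fst (hat_pair F)) x y" and ?B = "form_eval ?e (snd (hat_pair F)) x y"
  have AB: "(?A, ?B) \<noteq> 0" by (rule hat_pair_no_common_zero[OF F0 xy])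
  have ck: "c * k ^ ?e \<noteq> 0" using c k by simp
  have "cp1_pt ?A ?B = cp1_pt (c * k ^ ?e * ?A) (c * k ^ ?e * ?B)"
    using cp1_pt_eq_iff[OF AB, of "c * k ^ ?e * ?A" "c * k ^ ?e * ?B"] AB ck
    by (auto simp: zero_prod_def)
  also have "\<dots> = rat_map (proj_class F) (cp1_pt x y)"
    unfolding rat_map_def G_def[symmetric] Let_def x'y' prod.case e G
    by (simp add: form_eval_smult form_eval_scale k mult_ac)
  finally show ?thesis by simp
qed

text \<open>\<open>z - P z / P' z = (z * P' z - P z) / P' z\<close>\<close>

definition newton_pair :: "complex poly \<Rightarrow> form_pair" where
  "newton_pair P = ([:0, 1:] * pderiv P - P, pderiv P)"

definition newton_maps :: "nat \<Rightarrow> form_pair set set" where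
  "newton_maps d =
     {proj_class (newton_pair P) | P. lead_coeff P = 1 \<and> degree P = d \<and> card {z. poly P z = 0} = d}"

text \<open>Holomorphy into projective space: local holomorphic lifts without common zeros.\<close>

definition proj_holomorphic_on :: "nat \<Rightarrow> (complex \<Rightarrow> form_pair set) \<Rightarrow> complex set \<Rightarrow> bool" where
  "proj_holomorphic_on d N S \<longleftrightarrow>
     (\<forall>s\<in>S. \<exists>U F. open U \<and> s \<in> U \<and> U \<subseteq> S \<and>
        (\<forall>i. (\<lambda>t. coeff (fst (F t)) i) holomorphic_on U) \<and>
        (\<forall>i. (\<lambda>t. coeff (snd (F t)) i) holomorphic_on U) \<and>
        (\<forall>t\<in>U. F t \<in> form_pairs d \<and> N t = proj_class (F t)))"

definition holomorphic_newton_family :: "nat \<Rightarrow> (complex \<Rightarrow> form_pair set) \<Rightarrow> bool" where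
  "holomorphic_newton_family d N \<longleftrightarrow>
     proj_holomorphic_on d N (ball 0 1) \<and> (\<forall>t\<in>ball 0 1 - {0}. N t \<in> newton_maps d)"

definition borel_prob :: "'a::topological_space measure \<Rightarrow> bool" where
  "borel_prob M \<longleftrightarrow> prob_space M \<and> sets M = sets borel"

definition invariant_prob :: "('a::topological_space \<Rightarrow> 'a) \<Rightarrow> 'a measure \<Rightarrow> bool" where
  "invariant_prob f M \<longleftrightarrow> borel_prob M \<and> f \<in> measurable M M \<and> distr M M f = M"

definition finite_partitions :: "'a measure \<Rightarrow> 'a set set set" where
  "finite_partitions M = {P. finite P \<and> P \<subseteq> sets M \<and> partition_on (space M) P}"

text \<open>The common refinement of the preimages of \<open>P\<close> under the first \<open>n\<close> iterates of \<open>f\<close>.\<close>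

definition dyn_refinement :: "'a measure \<Rightarrow> ('a \<Rightarrow> 'a) \<Rightarrow> 'a set set \<Rightarrow> nat \<Rightarrow> 'a set set" where
  "dyn_refinement M f P n =
     {{x \<in> space M. \<forall>i<n. (f ^^ i) x \<in> A i} | A. \<forall>i<n. A i \<in> P}"

text \<open>The convention \<open>0 * ln 0 = 0\<close> is built in, and empty cells do not contribute.\<close>

definition partition_entropy :: "'a measure \<Rightarrow> 'a set set \<Rightarrow> real" where
  "partition_entropy M P = - (\<Sum>A\<in>P. measure M A * ln (measure M A))"

text \<open>
  The Kolmogorov--Sinai entropy. For invariant \<open>M\<close> the limit superior is a limit, by subadditivity.
\<close>

definition metric_entropy :: "'a measure \<Rightarrow> ('a \<Rightarrow> 'a) \<Rightarrow> ereal" where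
  "metric_entropy M f =
     (SUP P\<in>finite_partitions M.
        limsup (\<lambda>n. ereal (partition_entropy M (dyn_refinement M f P n) / real n)))"

definition maximal_measure :: "('a::topological_space \<Rightarrow> 'a) \<Rightarrow> 'a measure \<Rightarrow> bool" where
  "maximal_measure f M \<longleftrightarrow>
     invariant_prob f M \<and> (\<forall>M'. invariant_prob f M' \<longrightarrow> metric_entropy M' f \<le> metric_entropy M f)"

definition weak_limit ::
  "('i \<Rightarrow> 'a::topological_space measure) \<Rightarrow> 'a measure \<Rightarrow> 'i filter \<Rightarrow> bool" where
  "weak_limit M L F \<longleftrightarrow> borel_prob L \<and>
     (\<forall>g :: 'a \<Rightarrow> real. continuous_on UNIV g \<and> bounded (range g) \<longrightarrow>
        ((\<lambda>t. \<integral>x. g x \<partial>M t) \<longlongrightarrow> (\<integral>x. g x \<partial>L)) F)"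

end

theory Submission
  imports Defs
begin

text \<open>
  In the coordinate \<open>w = (z - a) / (z - b)\<close> the Newton map of \<open>(z - a) (z - b)\<close> is \<open>w \<mapsto> w\<^sup>2\<close>. Convergence
  to a point of \<open>indet_locus 2\<close> forces that point to be \<open>[Y\<^sup>2 : 0]\<close> and the roots to tend to infinity.

  The identification of the measure of maximal entropy of \<open>w \<mapsto> w\<^sup>2\<close> is replaced by an estimate. Lebesgue
  measure on the circle has entropy at least \<open>ln 2\<close>, so a maximal measure \<open>M\<close> does too. Code points
  by the half circle, or the side of the circle, that contains them. This partition generates modulo any
  invariant measure, so the entropy of its \<open>m\<close>-th refinement is at least \<open>m * ln 2\<close>; since the refinement
  has only \<open>2 ^ m + 2\<close> cells, every cell has mass \<open>O(1 / m)\<close>, uniformly in \<open>a\<close> and \<open>b\<close>. When \<open>b\<close> is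
  large, the part of the circle \<open>|w| = 1\<close> on which \<open>z\<close> stays bounded is a short arc, covered by boundedly
  many cells. Hence the mass of \<open>M\<close> outside a neighbourhood of infinity tends to zero.
\<close>

section \<open>Entropy of finite-valued random variables\<close>

text \<open>Entropy controls single cells only: a cell of mass \<open>q\<close> lowers the largest
  possible entropy by a multiple of \<open>q * m\<close>, so nearly full entropy makes
  \<open>q\<close> small, while a set made of a growing number of cells escapes. Hence the set to be
  shown light has to meet boundedly many cells, and the word length \<open>m\<close> is fixed first;
  the arc is shrunk below \<open>1 / 2 ^ m\<close> afterwards, by letting \<open>b\<close> grow.

  The coding is constant on each side of the circle and cannot separate points there. Invariance
  removes this obstacle: min(|w|, 1/|w|) is squared by the map while its integral stays the same, so
  only the circle and the two attracting fixed points carry mass.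

  The laborious direction is to bound the entropy of \<open>M\<close>, a supremum over all finite
  partitions, by the entropy of one block of the coding partition.

  Weak convergence is tested against the single function 1/(1+|z|). It is continuous and vanishes
  only at infinity, so the limit 0 of its integrals determines the limit measure.\<close>

definition rv_entropy :: "'a measure \<Rightarrow> ('a \<Rightarrow> 'b) \<Rightarrow> real" where
  "rv_entropy M X = - (\<Sum>v\<in>X ` space M. measure M (X -` {v} \<inter> space M) * ln (measure M (X -` {v} \<inter> space M)))"

text \<open>A word of symbols encodes a cell of the \<open>n\<close>-fold dynamical refinement, so
  that joining refinements becomes concatenation.\<close>

definition itinerary :: "('a \<Rightarrow> 'a) \<Rightarrow> ('a \<Rightarrow> 'b) \<Rightarrow> nat \<Rightarrow> 'a \<Rightarrow> 'b list" where
  "itinerary f X n x = map (\<lambda>i. X ((f ^^ i) x)) [0..<n]"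

lemma length_itinerary [simp]: "length (itinerary f X n x) = n"
  by (simp add: itinerary_def)

lemma nth_itinerary: "i < n \<Longrightarrow> itinerary f X n x ! i = X ((f ^^ i) x)"
  by (simp add: itinerary_def)

lemma itinerary_eq_iff:
  "itinerary f X n x = itinerary f X n y \<longleftrightarrow> (\<forall>i<n. X ((f ^^ i) x) = X ((f ^^ i) y))"
  by (auto simp: list_eq_iff_nth_eq nth_itinerary)

lemma take_itinerary: "m \<le> n \<Longrightarrow> take m (itinerary f X n x) = itinerary f X m x"
  by (rule nth_equalityI) (auto simp: nth_itinerary)

lemma itinerary_add:
  "itinerary f X (m + n) x = itinerary f X m x @ itinerary f X n ((f ^^ m) x)"
  by (rule nth_equalityI)
     (auto simp: nth_itinerary nth_append funpow_add[unfolded comp_def, THEN fun_cong, symmetric]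
       simp flip: comp_apply[of "f ^^ _" "f ^^ _"] funpow_add)

lemma itinerary_Suc: "itinerary f X (Suc n) x = X x # itinerary f X n (f x)"
  using itinerary_add[of f X 1 n x] by (simp add: itinerary_def)

lemma simple_function_comp_measurable:
  assumes "f \<in> measurable M M" "simple_function M X"
  shows "simple_function M (\<lambda>x. X (f x))"
proof -
  have sp: "f x \<in> space M" if "x \<in> space M" for x
    using assms(1) that by (rule measurable_space)
  show ?thesis
    unfolding simple_function_def
  proof (intro conjI ballI)
    show "finite ((\<lambda>x. X (f x)) ` space M)"
      by (rule finite_subset[of _ "X ` space M"]) (use sp assms(2) in \<open>auto simp: simple_function_def\<close>)
  next
    fix v assume "v \<in> (\<lambda>x. X (f x)) ` space M"
    then have "X -` {v} \<inter> space M \<in> sets M"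
      using sp assms(2) by (auto simp: simple_function_def)
    from measurable_sets[OF assms(1) this]
    show "(\<lambda>x. X (f x)) -` {v} \<inter> space M \<in> sets M"
      by (rule back_subst[where P = "\<lambda>S. S \<in> sets M"]) (use sp in auto)
  qed
qed

lemma simple_function_itinerary:
  assumes "f \<in> measurable M M" "simple_function M X"
  shows "simple_function M (itinerary f X n)"
proof (induction n)
  case 0
  show ?case by (simp add: itinerary_def)
next
  case (Suc n)
  have "simple_function M (\<lambda>x. X x # itinerary f X n (f x))"
    using simple_function_compose2[OF assms(2) simple_function_comp_measurable[OF assms(1) Suc], of "(#)"] .
  then show ?case by (simp add: itinerary_Suc[abs_def])
qed

text \<open>Values that are not attained have empty fibres and add \<open>0 * ln 0 = 0\<close>, so
  the index set may be enlarged to suit a comparison.\<close>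

lemma rv_entropy_mono_neutral:
  assumes "finite S" "X ` space M \<subseteq> S"
  shows "rv_entropy M X = - (\<Sum>v\<in>S. measure M (X -` {v} \<inter> space M) * ln (measure M (X -` {v} \<inter> space M)))"
proof -
  have "X -` {v} \<inter> space M = {}" if "v \<in> S - X ` space M" for v
    using that by auto
  then show ?thesis unfolding rv_entropy_def
    by (subst sum.mono_neutral_left[OF assms]) auto
qed

context prob_space
begin

lemma information_space_e: "information_space M (exp 1)"
  by unfold_locales auto

text \<open>Base \<open>exp 1\<close> turns the logarithm of information theory into
  \<open>ln\<close>; this makes data processing and the chain rule available for a sum of the same
  shape as \<open>partition_entropy\<close>.\<close>

lemma rv_entropy_eq:
  assumes "simple_function M X"
  shows "rv_entropy M X = entropy (exp 1) (count_space (X ` space M)) X"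
proof -
  interpret I: information_space M "exp 1" by (rule information_space_e)
  show ?thesis
    using I.entropy_simple_distributed[OF simple_distributedI[OF assms measure_nonneg refl]]
    by (simp add: rv_entropy_def log_def)
qed

lemma rv_entropy_fun_le:
  assumes "simple_function M X" "\<And>x. x \<in> space M \<Longrightarrow> Y x = g (X x)"
  shows "rv_entropy M Y \<le> rv_entropy M X"
proof -
  interpret I: information_space M "exp 1" by (rule information_space_e)
  have "Y -` {v} \<inter> space M = (g \<circ> X) -` {v} \<inter> space M" for v
    using assms(2) by auto
  moreover have "Y ` space M = (g \<circ> X) ` space M"
    using assms(2) by (auto intro!: image_cong)
  ultimately have "rv_entropy M Y = rv_entropy M (g \<circ> X)"
    by (simp only: rv_entropy_def)
  then show ?thesis
    using I.entropy_data_processing[OF assms(1), of g] assms(1)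
    by (simp add: rv_entropy_eq simple_function_compose)
qed

text \<open>The chain rule gives H(X) + H(Y|X), and conditioning does not increase entropy.\<close>

lemma rv_entropy_Pair_le:
  assumes "simple_function M X" "simple_function M Y"
  shows "rv_entropy M (\<lambda>x. (X x, Y x)) \<le> rv_entropy M X + rv_entropy M Y"
proof -
  interpret I: information_space M "exp 1" by (rule information_space_e)
  show ?thesis
    using I.entropy_chain_rule[OF assms] I.conditional_entropy_less_eq_entropy[OF assms(2,1)] assms
    by (simp add: rv_entropy_eq simple_function_Pair)
qed

lemma rv_entropy_nonneg: "0 \<le> rv_entropy M X"
proof -
  have "prob A * ln (prob A) \<le> 0" for A
    using prob_le_1[of A] measure_nonneg[of M A]
    by (cases "prob A = 0") (simp_all add: mult_nonneg_nonpos less_le)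
  then show ?thesis
    unfolding rv_entropy_def sum_negf[symmetric] by (intro sum_nonneg) simp
qed

end

lemma rv_entropy_invariant:
  assumes f: "f \<in> measurable M M" and inv: "distr M M f = M" and X: "simple_function M X"
    and M: "prob_space M"
  shows "rv_entropy M (\<lambda>x. X (f x)) = rv_entropy M X"
proof -
  have sp: "f x \<in> space M" if "x \<in> space M" for x
    using f that by (rule measurable_space)
  have fin: "finite (X ` space M)" using X by (simp add: simple_function_def)
  have "measure M ((\<lambda>x. X (f x)) -` {v} \<inter> space M) = measure M (X -` {v} \<inter> space M)"
    if "v \<in> X ` space M" for v
  proof -
    have "X -` {v} \<inter> space M \<in> sets M" using X that unfolding simple_function_def by blast
    then have "measure (distr M M f) (X -` {v} \<inter> space M) =
        measure M (f -` (X -` {v} \<inter> space M) \<inter> space M)"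
      by (rule measure_distr[OF f])
    moreover have "f -` (X -` {v} \<inter> space M) \<inter> space M = (\<lambda>x. X (f x)) -` {v} \<inter> space M"
      using sp by auto
    ultimately show ?thesis using inv by simp
  qed
  moreover have "rv_entropy M (\<lambda>x. X (f x)) =
      - (\<Sum>v\<in>X ` space M. measure M ((\<lambda>x. X (f x)) -` {v} \<inter> space M) *
          ln (measure M ((\<lambda>x. X (f x)) -` {v} \<inter> space M)))"
    by (rule rv_entropy_mono_neutral[OF fin]) (use sp in auto)
  ultimately show ?thesis unfolding rv_entropy_def by simp
qed

section \<open>Finite partitions as fibres of random variables\<close>

definition fibres :: "'a measure \<Rightarrow> ('a \<Rightarrow> 'b) \<Rightarrow> 'a set set" where
  "fibres M X = (\<lambda>v. X -` {v} \<inter> space M) ` (X ` space M)"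

lemma fibres_in_finite_partitions:
  assumes "simple_function M X"
  shows "fibres M X \<in> finite_partitions M"
  using assms
  by (auto simp: finite_partitions_def fibres_def simple_function_def partition_on_def disjoint_def)

text \<open>Sending each point to the cell that contains it turns a partition into a random
  variable, so the supremum in \<open>metric_entropy\<close> can be handled by itineraries.\<close>

lemma finite_partition_eq_fibres:
  assumes "P \<in> finite_partitions M"
  obtains X :: "'a \<Rightarrow> 'a set" where "simple_function M X" "fibres M X = P"
proof -
  have P: "finite P" "P \<subseteq> sets M" "\<Union>P = space M" "disjoint P" "{} \<notin> P"
    using assms by (auto simp: finite_partitions_def partition_on_def)
  define X where "X x = (THE C. C \<in> P \<and> x \<in> C)" for x
  have X: "X x = C" if "x \<in> C" "C \<in> P" for x C
    unfolding X_def
  proof (rule the_equality)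
    show "C \<in> P \<and> x \<in> C" using that by simp
    show "D = C" if "D \<in> P \<and> x \<in> D" for D
      using that \<open>x \<in> C\<close> \<open>C \<in> P\<close> disjointD[OF P(4), of D C] by blast
  qed
  have im: "X ` space M = P"
  proof
    show "X ` space M \<subseteq> P"
    proof
      fix C assume "C \<in> X ` space M"
      then obtain x D where "C = X x" "x \<in> D" "D \<in> P" using P(3) by blast
      then show "C \<in> P" using X[of x D] by simp
    qed
    show "P \<subseteq> X ` space M"
    proof
      fix C assume C: "C \<in> P"
      then obtain x where x: "x \<in> C" using P(5) by (metis ex_in_conv)
      then have "x \<in> space M" using C P(3) by blast
      then show "C \<in> X ` space M" using X[OF x C] by (rule rev_image_eqI[OF _ sym])
    qed
  qed
  have vi: "X -` {C} \<inter> space M = C" if "C \<in> P" for C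
  proof
    show "C \<subseteq> X -` {C} \<inter> space M"
      using that P(3) by (simp add: subset_iff X) blast
    show "X -` {C} \<inter> space M \<subseteq> C"
    proof
      fix x assume x: "x \<in> X -` {C} \<inter> space M"
      then obtain D where "x \<in> D" "D \<in> P" using P(3) by blast
      then show "x \<in> C" using X[of x D] x by simp
    qed
  qed
  show thesis
  proof
    show "simple_function M X"
      using im vi P by (auto simp: simple_function_def)
    show "fibres M X = P" unfolding fibres_def im using vi by auto
  qed
qed

text \<open>Nonempty cells of the refinement correspond to the words that occur. The refinement may
  also contain the empty set, from sequences of cells that no orbit follows; it adds nothing to the
  entropy.\<close>

lemma partition_entropy_dyn_refinement:
  assumes f: "f \<in> measurable M M" and X: "simple_function M X"
  shows "partition_entropy M (dyn_refinement M f (fibres M X) n) = rv_entropy M (itinerary f X n)"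
proof -
  let ?I = "itinerary f X n" and ?R = "dyn_refinement M f (fibres M X) n"
  define c where "c v = ?I -` {v} \<inter> space M" for v
  have sp: "(f ^^ i) x \<in> space M" if "x \<in> space M" for x i
    using measurable_compose_n[OF f, of i] that by (rule measurable_space)
  have fin: "finite (?I ` space M)"
    using simple_function_itinerary[OF f X] by (simp add: simple_function_def)
  have c_in: "c v \<in> ?R" if v: "v \<in> ?I ` space M" for v
  proof -
    obtain y where y: "y \<in> space M" "v = ?I y" using v by blast
    have "c v = {x \<in> space M. \<forall>i<n. (f ^^ i) x \<in> X -` {X ((f ^^ i) y)} \<inter> space M}"
      unfolding c_def y by (auto simp: itinerary_eq_iff sp)
    moreover have "\<forall>i<n. X -` {X ((f ^^ i) y)} \<inter> space M \<in> fibres M X"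
      using sp[OF y(1)] unfolding fibres_def by blast
    ultimately show ?thesis
      unfolding dyn_refinement_def mem_Collect_eq
      by (intro exI[of _ "\<lambda>i. X -` {X ((f ^^ i) y)} \<inter> space M"] conjI)
  qed
  have R_sub: "S = {} \<or> S \<in> c ` ?I ` space M" if "S \<in> ?R" for S
  proof -
    obtain A where A: "S = {x \<in> space M. \<forall>i<n. (f ^^ i) x \<in> A i}" "\<forall>i<n. A i \<in> fibres M X"
      using \<open>S \<in> ?R\<close> unfolding dyn_refinement_def by blast
    have A': "x \<in> A i \<longleftrightarrow> X x = X y" if "i < n" "y \<in> A i" "x \<in> space M" for x y i
    proof -
      obtain z where "A i = X -` {X z} \<inter> space M" using A(2) \<open>i < n\<close> by (auto simp: fibres_def)
      then show ?thesis using that by auto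
    qed
    show ?thesis
    proof (cases "S = {}")
      case False
      then obtain y where y: "y \<in> S" by blast
      then have y': "y \<in> space M" "\<And>i. i < n \<Longrightarrow> (f ^^ i) y \<in> A i" by (simp_all add: A(1))
      have "x \<in> S \<longleftrightarrow> x \<in> c (?I y)" for x
        using A'[OF _ y'(2) sp, of _ x] by (auto simp: A(1) c_def itinerary_eq_iff)
      then have "S = c (?I y)" by blast
      then show ?thesis using y'(1) by blast
    qed simp
  qed
  have finR: "finite ?R"
    by (rule finite_subset[of _ "insert {} (c ` ?I ` space M)"]) (use R_sub fin in auto)
  have inj: "inj_on c (?I ` space M)"
    by (rule inj_onI) (auto simp: c_def)
  have "(\<Sum>A\<in>?R. measure M A * ln (measure M A)) =
      (\<Sum>A\<in>c ` ?I ` space M. measure M A * ln (measure M A))"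
    by (rule sum.mono_neutral_right[OF finR]) (use R_sub c_in in fastforce)+
  also have "\<dots> = (\<Sum>v\<in>?I ` space M. measure M (c v) * ln (measure M (c v)))"
    by (rule sum.reindex[OF inj, unfolded comp_def])
  finally show ?thesis by (simp add: partition_entropy_def rv_entropy_def c_def)
qed

section \<open>Bounds for \<open>- (x * ln x)\<close>\<close>

lemma neg_mult_ln_le_sqrt:
  fixes x :: real
  assumes "0 \<le> x"
  shows "- (x * ln x) \<le> 2 * sqrt x"
proof (cases "x = 0")
  case False
  then have x: "0 < x" using assms by simp
  then have s: "0 < sqrt x" by simp
  \<comment> \<open>Passing to the square root before applying \<open>ln y \<le> y - 1\<close>
    leaves a factor \<open>sqrt x\<close>, which tends to 0 with \<open>x\<close>.\<close>
  have "- ln x = 2 * ln (inverse (sqrt x))"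
    using x by (simp add: ln_inverse ln_sqrt)
  also have "\<dots> \<le> 2 * inverse (sqrt x)"
    using ln_le_minus_one[of "inverse (sqrt x)"] s by simp
  finally have "x * (- ln x) \<le> x * (2 * inverse (sqrt x))"
    using x by (intro mult_left_mono) auto
  also have "\<dots> = 2 * sqrt x"
    using x by (simp add: field_simps)
  finally show ?thesis by simp
qed simp

text \<open>One term of Gibbs' inequality: \<open>ln y \<le> y - 1\<close> at
  \<open>y = u / x\<close>. Summed with a uniform weight \<open>u\<close> it bounds entropy by the
  logarithm of the number of cells; with \<open>u = 1\<close> it gives
  \<open>- (x * ln x) \<le> 1 - x\<close>.\<close>

lemma neg_mult_ln_le_diff:
  fixes x u :: real
  assumes "0 \<le> x" "0 < u"
  shows "- (x * ln x) \<le> u - x - x * ln u"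
proof (cases "x = 0")
  case False
  then have x: "0 < x" using assms by simp
  have "x * ln (u / x) \<le> x * (u / x - 1)"
    using ln_le_minus_one[of "u / x"] x assms by (intro mult_left_mono) auto
  also have "\<dots> = u - x" using x by (simp add: field_simps)
  finally show ?thesis using x assms by (simp add: ln_div algebra_simps)
qed (use assms in simp)

text \<open>The value \<open>None\<close> has probability \<open>1 - p\<close> and costs at most
  \<open>p\<close>; every other value has probability at most \<open>p\<close> and costs at most
  \<open>2 * sqrt p\<close>.\<close>

lemma (in prob_space) rv_entropy_discrepancy_le:
  assumes X: "simple_function M X" and Y: "simple_function M Y"
  defines "p \<equiv> prob {x \<in> space M. X x \<noteq> Y x}"
  shows "rv_entropy M (\<lambda>x. if X x \<noteq> Y x then Some (X x) else None)
    \<le> p + 2 * real (card (X ` space M)) * sqrt p"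
proof -
  let ?Z = "\<lambda>x. if X x \<noteq> Y x then Some (X x) else None"
  let ?q = "\<lambda>v. prob (?Z -` {v} \<inter> space M)"
  let ?S = "X ` space M"
  have fin: "finite ?S" using X by (simp add: simple_function_def)
  have sXY: "simple_function M (\<lambda>x. (X x, Y x))" by (rule simple_function_Pair[OF X Y])
  have meas: "{x \<in> space M. X x \<noteq> Y x} \<in> sets M"
    using simple_functionD(2)[OF sXY, of "{(a, b). a \<noteq> b}"]
    by (rule back_subst[where P = "\<lambda>S. S \<in> sets M"]) auto
  have p: "0 \<le> p" "p \<le> 1" by (simp_all add: p_def)
  have "rv_entropy M ?Z = - (\<Sum>v\<in>insert None (Some ` ?S). ?q v * ln (?q v))"
    by (rule rv_entropy_mono_neutral) (use fin in auto)
  also have "\<dots> = - (?q None * ln (?q None)) + (\<Sum>v\<in>?S. - (?q (Some v) * ln (?q (Some v))))"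
    using fin by (simp add: sum.reindex sum_negf)
  also have "\<dots> \<le> p + (\<Sum>v\<in>?S. 2 * sqrt p)"
  proof (intro add_mono sum_mono)
    have "?Z -` {None} \<inter> space M = space M - {x \<in> space M. X x \<noteq> Y x}" by (auto split: if_splits)
    then have "?q None = 1 - p" using meas by (simp add: p_def prob_compl)
    then show "- (?q None * ln (?q None)) \<le> p"
      using neg_mult_ln_le_diff[of "1 - p" 1] p by simp
  next
    fix v
    have "?q (Some v) \<le> p" unfolding p_def
      by (rule finite_measure_mono) (use meas in \<open>auto split: if_splits\<close>)
    then have "sqrt (?q (Some v)) \<le> sqrt p" by simp
    then show "- (?q (Some v) * ln (?q (Some v))) \<le> 2 * sqrt p"
      using neg_mult_ln_le_sqrt[OF measure_nonneg, of M "?Z -` {Some v} \<inter> space M"] by linarith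
  qed
  finally show ?thesis by simp
qed

section \<open>Subadditivity of block entropy for an invariant measure\<close>

context
  fixes M :: "'a measure" and f :: "'a \<Rightarrow> 'a"
  assumes prob_M: "prob_space M" and f_meas: "f \<in> measurable M M" and f_inv: "distr M M f = M"
begin

interpretation prob_space M by (rule prob_M)

lemma distr_funpow: "distr M M (f ^^ n) = M"
proof (induction n)
  case 0
  show ?case by (simp add: id_def distr_id)
next
  case (Suc n)
  have "distr M M (f ^^ Suc n) = distr (distr M M (f ^^ n)) M f"
    using distr_distr[OF f_meas measurable_compose_n[OF f_meas, of n]] by (simp only: funpow.simps)
  then show ?case by (simp only: Suc f_inv)
qed

text \<open>The second block of a word is the word of the shifted point \<open>(f ^^ m) x\<close>,
  which by invariance has the same distribution as the word of \<open>x\<close>.\<close>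

lemma rv_entropy_itinerary_add_le:
  assumes "simple_function M X"
  shows "rv_entropy M (itinerary f X (m + n))
    \<le> rv_entropy M (itinerary f X m) + rv_entropy M (itinerary f X n)"
proof -
  note sf = simple_function_itinerary[OF f_meas assms]
  note fm = measurable_compose_n[OF f_meas, of m]
  note sf' = simple_function_comp_measurable[OF fm sf]
  have "rv_entropy M (itinerary f X (m + n))
      \<le> rv_entropy M (\<lambda>x. (itinerary f X m x, itinerary f X n ((f ^^ m) x)))"
    by (rule rv_entropy_fun_le[where g = "\<lambda>(a, b). a @ b"])
      (auto simp: itinerary_add intro!: simple_function_Pair sf sf')
  also have "\<dots> \<le> rv_entropy M (itinerary f X m) + rv_entropy M (\<lambda>x. itinerary f X n ((f ^^ m) x))"
    by (rule rv_entropy_Pair_le[OF sf sf'])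
  also have "rv_entropy M (\<lambda>x. itinerary f X n ((f ^^ m) x)) = rv_entropy M (itinerary f X n)"
    by (rule rv_entropy_invariant[OF fm distr_funpow sf prob_M])
  finally show ?thesis .
qed

lemma rv_entropy_itinerary_mult_le:
  assumes "simple_function M X"
  shows "rv_entropy M (itinerary f X (q * m)) \<le> real q * rv_entropy M (itinerary f X m)"
proof (induction q)
  case 0
  have "rv_entropy M (itinerary f X 0) = 0"
    using prob_space subprob_not_empty
    by (simp add: rv_entropy_def itinerary_def image_constant_conv vimage_def)
  then show ?case by simp
next
  case (Suc q)
  have "rv_entropy M (itinerary f X (Suc q * m))
      \<le> rv_entropy M (itinerary f X m) + rv_entropy M (itinerary f X (q * m))"
    using rv_entropy_itinerary_add_le[OF assms, of m "q * m"] by simp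
  then show ?case using Suc by (simp add: algebra_simps)
qed

lemma rv_entropy_itinerary_le:
  assumes X: "simple_function M X" and m: "0 < m"
  shows "rv_entropy M (itinerary f X n) \<le> (real n / real m + 1) * rv_entropy M (itinerary f X m)"
proof -
  \<comment> \<open>Round \<open>n\<close> up to a multiple of \<open>m\<close>; the longer word
    determines the shorter one through \<open>take n\<close>.\<close>
  let ?q = "n div m + 1"
  have le: "n \<le> ?q * m"
    using m by (metis add_mult_distrib div_mult_mod_eq add_left_mono mod_less_divisor
        nat_mult_1 less_imp_le)
  have "rv_entropy M (itinerary f X n) \<le> rv_entropy M (itinerary f X (?q * m))"
    by (rule rv_entropy_fun_le[where g = "take n"])
      (use le in \<open>auto simp: take_itinerary intro: simple_function_itinerary[OF f_meas X]\<close>)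
  also have "\<dots> \<le> real ?q * rv_entropy M (itinerary f X m)"
    by (rule rv_entropy_itinerary_mult_le[OF X])
  also have "\<dots> \<le> (real n / real m + 1) * rv_entropy M (itinerary f X m)"
    by (intro mult_right_mono rv_entropy_nonneg) (simp add: of_nat_div_le_of_nat)
  finally show ?thesis .
qed

end

section \<open>Generating partitions\<close>

definition cylinder_set :: "'a measure \<Rightarrow> ('a \<Rightarrow> 'a) \<Rightarrow> ('a \<Rightarrow> 'b) \<Rightarrow> nat \<Rightarrow> 'b list set \<Rightarrow> 'a set" where
  "cylinder_set M f X k B = {x \<in> space M. itinerary f X k x \<in> B}"

text \<open>Approximation in measure by events that depend on finitely many symbols. That all
  measurable sets have this property is how \<open>X\<close> being a generator modulo
  \<open>M\<close> is expressed.\<close>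

definition cylinder_approximable :: "'a measure \<Rightarrow> ('a \<Rightarrow> 'a) \<Rightarrow> ('a \<Rightarrow> 'b) \<Rightarrow> 'a set \<Rightarrow> bool" where
  "cylinder_approximable M f X A \<longleftrightarrow> A \<in> sets M \<and>
     (\<forall>\<epsilon>>0. \<exists>k B. measure M ((A - cylinder_set M f X k B) \<union> (cylinder_set M f X k B - A)) < \<epsilon>)"

text \<open>Lets cylinders of finitely many different lengths be combined at a common
  length.\<close>

lemma cylinder_set_extend:
  "k \<le> l \<Longrightarrow> cylinder_set M f X k B = cylinder_set M f X l {c. take k c \<in> B}"
  by (auto simp: cylinder_set_def take_itinerary)

text \<open>A variable that reads \<open>k\<close> symbols from time \<open>i\<close> on sees a
  window of one longer word; the overhead \<open>k\<close> does not grow with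
  \<open>n\<close>.\<close>

lemma itinerary_window:
  assumes "i < n"
  shows "itinerary f X k ((f ^^ i) x) = take k (drop i (itinerary f X (n + k) x))"
proof -
  have eq: "n + k = i + (k + (n - i))" using assms by simp
  have "itinerary f X (n + k) x =
      itinerary f X i x @ itinerary f X k ((f ^^ i) x) @ itinerary f X (n - i) ((f ^^ k) ((f ^^ i) x))"
    unfolding eq itinerary_add ..
  then show ?thesis by simp
qed

context
  fixes M :: "'a measure" and f :: "'a \<Rightarrow> 'a" and X :: "'a \<Rightarrow> 'b"
  assumes prob_M: "prob_space M" and f_meas: "f \<in> measurable M M"
    and X: "simple_function M X"
begin

interpretation prob_space M by (rule prob_M)

lemma cylinder_set_measurable: "cylinder_set M f X k B \<in> sets M"
proof -
  have "itinerary f X k -` B \<inter> space M \<in> sets M"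
    using simple_functionD(2)[OF simple_function_itinerary[OF f_meas X]] .
  then show ?thesis
    by (rule back_subst[where P = "\<lambda>S. S \<in> sets M"]) (auto simp: cylinder_set_def)
qed

lemma cylinder_approximable_cylinder_set: "cylinder_approximable M f X (cylinder_set M f X k B)"
  unfolding cylinder_approximable_def
  by (auto intro!: cylinder_set_measurable exI[of _ k] exI[of _ B])

lemma cylinder_approximable_compl:
  assumes "cylinder_approximable M f X A"
  shows "cylinder_approximable M f X (space M - A)"
  unfolding cylinder_approximable_def
proof (intro conjI allI impI)
  show "space M - A \<in> sets M" using assms by (auto simp: cylinder_approximable_def)
  fix \<epsilon> :: real assume "\<epsilon> > 0"
  then obtain k B where kB:
    "measure M ((A - cylinder_set M f X k B) \<union> (cylinder_set M f X k B - A)) < \<epsilon>"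
    using assms unfolding cylinder_approximable_def by blast
  have "A \<subseteq> space M"
    using assms sets.sets_into_space by (auto simp: cylinder_approximable_def)
  then have "((space M - A) - cylinder_set M f X k (- B)) \<union> (cylinder_set M f X k (- B) - (space M - A)) =
    (A - cylinder_set M f X k B) \<union> (cylinder_set M f X k B - A)"
    by (auto simp: cylinder_set_def)
  then show "\<exists>k B. measure M (((space M - A) - cylinder_set M f X k B) \<union>
      (cylinder_set M f X k B - (space M - A))) < \<epsilon>"
    using kB by metis
qed

lemma cylinder_approximable_AE:
  assumes A: "cylinder_approximable M f X A" and A': "A' \<in> sets M"
    and ae: "AE x in M. x \<in> A \<longleftrightarrow> x \<in> A'"
  shows "cylinder_approximable M f X A'"
  unfolding cylinder_approximable_def
proof (intro conjI allI impI A')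
  fix \<epsilon> :: real assume "\<epsilon> > 0"
  then obtain k B where kB:
    "measure M ((A - cylinder_set M f X k B) \<union> (cylinder_set M f X k B - A)) < \<epsilon>"
    using A unfolding cylinder_approximable_def by blast
  have "measure M ((A' - cylinder_set M f X k B) \<union> (cylinder_set M f X k B - A')) =
      measure M ((A - cylinder_set M f X k B) \<union> (cylinder_set M f X k B - A))"
  proof (rule measure_eq_AE)
    show "AE x in M. (x \<in> A' - cylinder_set M f X k B \<union> (cylinder_set M f X k B - A')) \<longleftrightarrow>
      (x \<in> A - cylinder_set M f X k B \<union> (cylinder_set M f X k B - A))"
      using ae by eventually_elim auto
  qed (use A A' cylinder_set_measurable in \<open>auto simp: cylinder_approximable_def\<close>)
  then show "\<exists>k B. measure M ((A' - cylinder_set M f X k B) \<union> (cylinder_set M f X k B - A')) < \<epsilon>"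
    using kB by metis
qed

text \<open>By continuity from below, \<open>n\<close> of the sets exhaust the union up to
  \<open>\<epsilon> / 2\<close>; each of these is approximated within
  \<open>\<epsilon> / (2 * real n)\<close>, and the cylinders are brought to a common
  length.\<close>

lemma cylinder_approximable_UN:
  fixes A :: "nat \<Rightarrow> 'a set"
  assumes "\<And>i. cylinder_approximable M f X (A i)"
  shows "cylinder_approximable M f X (\<Union>i. A i)"
  unfolding cylinder_approximable_def
proof (intro conjI allI impI)
  have A: "A i \<in> sets M" for i using assms by (auto simp: cylinder_approximable_def)
  then show UA: "(\<Union>i. A i) \<in> sets M" by auto
  fix \<epsilon> :: real assume \<epsilon>: "\<epsilon> > 0"
  define U where "U n = (\<Union>i<n. A i)" for n
  have Um: "U n \<in> sets M" for n unfolding U_def using A by auto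
  have "(\<lambda>n. measure M (U n)) \<longlonglongrightarrow> measure M (\<Union>n. U n)"
    by (rule finite_Lim_measure_incseq)
       (use Um in \<open>auto simp: U_def incseq_def dest: less_le_trans\<close>)
  moreover have "(\<Union>n. U n) = (\<Union>i. A i)" by (auto simp: U_def)
  ultimately have "(\<lambda>n. measure M (U n)) \<longlonglongrightarrow> measure M (\<Union>i. A i)" by simp
  then have "eventually (\<lambda>n. measure M (U n) > measure M (\<Union>i. A i) - \<epsilon> / 2) sequentially"
    by (rule order_tendstoD) (use \<epsilon> in simp)
  then have "eventually (\<lambda>n. measure M (U n) > measure M (\<Union>i. A i) - \<epsilon> / 2 \<and> n > 0) sequentially"
    using eventually_gt_at_top[of 0] by (rule eventually_conj)
  then obtain n where n: "measure M (U n) > measure M (\<Union>i. A i) - \<epsilon> / 2" "n > 0"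
    using eventually_happens by fastforce
  define D where "D i k B = (A i - cylinder_set M f X k B) \<union> (cylinder_set M f X k B - A i)" for i k B
  have Dm: "D i k B \<in> sets M" for i k B
    unfolding D_def using A cylinder_set_measurable by auto
  have "\<epsilon> / (2 * real n) > 0" using \<epsilon> n by simp
  then have "\<exists>k B. measure M (D i k B) < \<epsilon> / (2 * real n)" for i
    using assms[of i] unfolding cylinder_approximable_def D_def by blast
  then obtain k B where kB: "\<And>i. measure M (D i (k i) (B i)) < \<epsilon> / (2 * real n)" by metis
  define l where "l = Max (k ` {..<n})"
  define B' where "B' = (\<Union>i<n. {c. take (k i) c \<in> B i})"
  have "cylinder_set M f X (k i) (B i) = cylinder_set M f X l {c. take (k i) c \<in> B i}" if "i < n" for i
    by (rule cylinder_set_extend) (use that in \<open>auto simp: l_def\<close>)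
  then have cyl: "cylinder_set M f X l B' = (\<Union>i<n. cylinder_set M f X (k i) (B i))"
    by (auto simp: B'_def cylinder_set_def)
  have "measure M (((\<Union>i. A i) - cylinder_set M f X l B') \<union> (cylinder_set M f X l B' - (\<Union>i. A i)))
      \<le> measure M (((\<Union>i. A i) - U n) \<union> (\<Union>i<n. D i (k i) (B i)))"
    by (rule finite_measure_mono) (use UA Um Dm in \<open>auto simp: cyl D_def U_def\<close>)
  also have "\<dots> \<le> measure M ((\<Union>i. A i) - U n) + measure M (\<Union>i<n. D i (k i) (B i))"
    by (rule measure_Un_le) (use UA Um Dm in auto)
  also have "\<dots> < \<epsilon> / 2 + \<epsilon> / 2"
  proof (rule add_less_le_mono)
    have "measure M ((\<Union>i. A i) - U n) = measure M (\<Union>i. A i) - measure M (U n)"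
      by (rule finite_measure_Diff) (use UA Um in \<open>auto simp: U_def\<close>)
    then show "measure M ((\<Union>i. A i) - U n) < \<epsilon> / 2" using n by simp
    have "measure M (\<Union>i<n. D i (k i) (B i)) \<le> (\<Sum>i<n. measure M (D i (k i) (B i)))"
      by (rule finite_measure_subadditive_finite) (use Dm in auto)
    also have "\<dots> \<le> (\<Sum>i<n. \<epsilon> / (2 * real n))"
      using kB by (intro sum_mono less_imp_le)
    also have "\<dots> = \<epsilon> / 2" using n by simp
    finally show "measure M (\<Union>i<n. D i (k i) (B i)) \<le> \<epsilon> / 2" .
  qed
  finally show "\<exists>k B. measure M (((\<Union>i. A i) - cylinder_set M f X k B) \<union>
      (cylinder_set M f X k B - (\<Union>i. A i))) < \<epsilon>" by auto
qed

text \<open>Each fibre of \<open>W\<close> is close to a cylinder, so a word reveals the value of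
  \<open>W\<close> as the one whose cylinder contains it.\<close>

lemma simple_function_cylinder_approx:
  assumes W: "simple_function M W"
    and approx: "\<And>A. A \<in> sets M \<Longrightarrow> cylinder_approximable M f X A" and \<epsilon>: "(0::real) < \<epsilon>"
  obtains k g where "prob {x \<in> space M. W x \<noteq> g (itinerary f X k x)} < \<epsilon>"
proof -
  define S where "S = W ` space M"
  have S: "finite S" "S \<noteq> {}" using W not_empty by (auto simp: S_def simple_function_def)
  define F where "F v = W -` {v} \<inter> space M" for v
  have F: "F v \<in> sets M" for v unfolding F_def by (rule simple_functionD(2)[OF W])
  define D where "D v k B = (F v - cylinder_set M f X k B) \<union> (cylinder_set M f X k B - F v)" for v k B
  have Dm: "D v k B \<in> sets M" for v k B
    unfolding D_def using F cylinder_set_measurable by auto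
  have "\<epsilon> / card S > 0" using \<epsilon> S by (simp add: card_gt_0_iff)
  then have "\<exists>k B. measure M (D v k B) < \<epsilon> / card S" for v
    using approx[OF F, of v] unfolding cylinder_approximable_def D_def by blast
  then obtain k B where kB: "\<And>v. measure M (D v (k v) (B v)) < \<epsilon> / card S" by metis
  define l where "l = Max (k ` S)"
  have kl: "k v \<le> l" if "v \<in> S" for v using S that by (simp add: l_def)
  \<comment> \<open>Outside the symmetric differences \<open>D\<close> the word lies in the cylinder
    of the true value and in no other, which makes the choice correct there; elsewhere it is
    arbitrary.\<close>
  define g where "g c = (SOME v. v \<in> S \<and> take (k v) c \<in> B v)" for c
  have bad: "x \<in> (\<Union>v\<in>S. D v (k v) (B v))"
    if x: "x \<in> space M" "W x \<noteq> g (itinerary f X l x)" for x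
  proof (rule ccontr)
    assume nx: "x \<notin> (\<Union>v\<in>S. D v (k v) (B v))"
    have mem: "take (k v) (itinerary f X l x) \<in> B v \<longleftrightarrow> W x = v" if "v \<in> S" for v
    proof -
      have "x \<notin> D v (k v) (B v)" using nx that by blast
      then show ?thesis using x kl[OF that]
        by (auto simp: D_def F_def cylinder_set_def take_itinerary)
    qed
    have "W x \<in> S" using x by (simp add: S_def)
    then have "g (itinerary f X l x) = W x"
      unfolding g_def using mem by (intro some_equality) auto
    with x show False by simp
  qed
  have "prob {x \<in> space M. W x \<noteq> g (itinerary f X l x)} \<le> prob (\<Union>v\<in>S. D v (k v) (B v))"
    by (rule finite_measure_mono) (use bad Dm S in auto)
  also have "\<dots> \<le> (\<Sum>v\<in>S. prob (D v (k v) (B v)))"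
    by (rule finite_measure_subadditive_finite) (use Dm S in auto)
  also have "\<dots> < (\<Sum>v\<in>S. \<epsilon> / card S)"
    using S kB by (intro sum_strict_mono) auto
  also have "\<dots> = \<epsilon>" using S by simp
  finally show thesis by (rule that)
qed

text \<open>
  This half of the Kolmogorov--Sinai theorem needs no conditional entropy: outside a set of small
  measure a given partition \<open>W\<close> is a function of \<open>X\<close>-itineraries, and the remaining information
  sits in the random variable \<open>Z\<close> that records \<open>W\<close> on the exceptional set only.
\<close>

theorem metric_entropy_le_rv_entropy:
  assumes f_inv: "distr M M f = M"
    and approx: "\<And>A. A \<in> sets M \<Longrightarrow> cylinder_approximable M f X A" and m: "0 < m"
  shows "metric_entropy M f \<le> ereal (rv_entropy M (itinerary f X m) / real m)"
  unfolding metric_entropy_def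
proof (rule SUP_least)
  fix P assume P: "P \<in> finite_partitions M"
  obtain W :: "'a \<Rightarrow> 'a set" where W: "simple_function M W" and PW: "fibres M W = P"
    using finite_partition_eq_fibres[OF P] .
  let ?H = "rv_entropy M (itinerary f X m)"
  let ?c = "card (W ` space M)"
  show "limsup (\<lambda>n. ereal (partition_entropy M (dyn_refinement M f P n) / real n)) \<le> ereal (?H / real m)"
  proof (rule ereal_le_epsilon2)
    fix \<epsilon> :: real assume \<epsilon>: "0 < \<epsilon>"
    \<comment> \<open>The square pays for the root in the entropy bound for \<open>Z\<close>. The
      cap 1 gives \<open>p \<le> sqrt p\<close>, so both terms of that bound fit under
      \<open>(1 + 2 * real ?c) * sqrt p\<close>.\<close>
    define \<delta> where "\<delta> = min 1 ((\<epsilon> / (1 + 2 * real ?c))\<^sup>2)"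
    have \<delta>: "0 < \<delta>" using \<epsilon> by (simp add: \<delta>_def)
    obtain k g where kg: "prob {x \<in> space M. W x \<noteq> g (itinerary f X k x)} < \<delta>"
      using simple_function_cylinder_approx[OF W approx \<delta>] .
    define Y where "Y x = g (itinerary f X k x)" for x
    have Y: "simple_function M Y"
      unfolding Y_def using simple_function_compose1[OF simple_function_itinerary[OF f_meas X]] .
    define Z where "Z x = (if W x \<noteq> Y x then Some (W x) else None)" for x
    have Z: "simple_function M Z"
      unfolding Z_def
      using simple_function_compose2[OF W Y, of "\<lambda>w y. if w \<noteq> y then Some w else None"] .
    have HZ: "rv_entropy M Z \<le> \<epsilon>"
    proof -
      define p where "p = prob {x \<in> space M. W x \<noteq> Y x}"
      have p: "0 \<le> p" "p \<le> 1" "p \<le> (\<epsilon> / (1 + 2 * real ?c))\<^sup>2"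
        using kg by (simp_all add: p_def Y_def \<delta>_def)
      have "p * p \<le> p" using p by (simp add: mult_left_le)
      then have "p \<le> sqrt p" using p by (intro real_le_rsqrt) (simp add: power2_eq_square)
      moreover have "sqrt p \<le> \<epsilon> / (1 + 2 * real ?c)"
        using p \<epsilon> by (intro real_le_lsqrt) auto
      then have "(1 + 2 * real ?c) * sqrt p \<le> \<epsilon>"
        by (simp add: field_simps)
      moreover have "rv_entropy M Z \<le> p + 2 * real ?c * sqrt p"
        unfolding Z_def p_def by (rule rv_entropy_discrepancy_le[OF W Y])
      ultimately show ?thesis by (simp add: algebra_simps)
    qed
    have bound: "rv_entropy M (itinerary f W n) \<le>
        (real (n + k) / real m + 1) * ?H + real n * \<epsilon>" for n
    proof -
      note sY = simple_function_itinerary[OF f_meas Y]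
      note sZ = simple_function_itinerary[OF f_meas Z]
      \<comment> \<open>\<open>Z\<close> corrects the guess \<open>Y\<close>: \<open>Some w\<close>
        overrides it, \<open>None\<close> confirms it.\<close>
      have "rv_entropy M (itinerary f W n) \<le> rv_entropy M (\<lambda>x. (itinerary f Y n x, itinerary f Z n x))"
        by (rule rv_entropy_fun_le[where g = "\<lambda>(ys, zs). map2 (\<lambda>y z. case z of Some w \<Rightarrow> w | None \<Rightarrow> y) ys zs"])
           (intro simple_function_Pair sY sZ, rule nth_equalityI, simp_all add: nth_itinerary Z_def)
      also have "\<dots> \<le> rv_entropy M (itinerary f Y n) + rv_entropy M (itinerary f Z n)"
        by (rule rv_entropy_Pair_le[OF sY sZ])
      finally have 1: "rv_entropy M (itinerary f W n) \<le> rv_entropy M (itinerary f Y n) + rv_entropy M (itinerary f Z n)" .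
      \<comment> \<open>\<open>Y\<close> looks \<open>k\<close> symbols ahead, so \<open>n\<close>
        of its values are read off an \<open>X\<close>-word of length \<open>n + k\<close>.\<close>
      have "rv_entropy M (itinerary f Y n) \<le> rv_entropy M (itinerary f X (n + k))"
        by (rule rv_entropy_fun_le[where g = "\<lambda>l. map (\<lambda>i. g (take k (drop i l))) [0..<n]"])
           (auto intro!: simple_function_itinerary[OF f_meas X] simp: itinerary_window[of _ n] 
             itinerary_def[of f Y] Y_def)
      also have "\<dots> \<le> (real (n + k) / real m + 1) * ?H"
        by (rule rv_entropy_itinerary_le[OF prob_M f_meas f_inv X m])
      finally have 2: "rv_entropy M (itinerary f Y n) \<le> (real (n + k) / real m + 1) * ?H" .
      have 3: "rv_entropy M (itinerary f Z n) \<le> real n * rv_entropy M (itinerary f Z 1)"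
        using rv_entropy_itinerary_mult_le[OF prob_M f_meas f_inv Z, of n 1] by simp
      have "rv_entropy M (itinerary f Z 1) \<le> rv_entropy M Z"
        by (rule rv_entropy_fun_le[where g = "\<lambda>z. [z]", OF Z]) (simp add: itinerary_def)
      then have "real n * rv_entropy M (itinerary f Z 1) \<le> real n * \<epsilon>"
        using HZ by (intro mult_left_mono) auto
      with 1 2 3 show ?thesis by linarith
    qed
    \<comment> \<open>The look-ahead \<open>k\<close> and the rounding to a multiple of
      \<open>m\<close> are constant costs, lost after division by \<open>n\<close>.\<close>
    let ?b = "\<lambda>n. ?H / real m + \<epsilon> + (real k / real m + 1) * ?H * inverse (real n)"
    have "limsup (\<lambda>n. ereal (partition_entropy M (dyn_refinement M f P n) / real n)) \<le>
        limsup (\<lambda>n. ereal (?b n))"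
    proof (rule Limsup_mono, rule eventually_mono[OF eventually_gt_at_top[of 0]])
      fix n :: nat assume n: "0 < n"
      have "partition_entropy M (dyn_refinement M f P n) = rv_entropy M (itinerary f W n)"
        unfolding PW[symmetric] by (rule partition_entropy_dyn_refinement[OF f_meas W])
      then have "partition_entropy M (dyn_refinement M f P n) / real n \<le>
          ((real (n + k) / real m + 1) * ?H + real n * \<epsilon>) / real n"
        using bound[of n] by (intro divide_right_mono) simp_all
      also have "\<dots> = ?b n"
      proof -
        have "((real (n + k) / real m + 1) * H + real n * \<epsilon>) / real n =
          H / real m + \<epsilon> + (real k / real m + 1) * H * inverse (real n)" for H
        proof -
          have "(real (n + k) / real m + 1) * H + real n * \<epsilon> =
              real n * (H / real m + \<epsilon>) + (real k / real m + 1) * H"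
            by (simp add: add_divide_distrib algebra_simps)
          moreover have "(real n * A + B) / real n = A + B * inverse (real n)" for A B :: real
            using n by (subst add_divide_distrib) (simp add: divide_inverse)
          ultimately show ?thesis by (rule trans[OF arg_cong[where f = "\<lambda>x. x / real n"]])
        qed
        then show ?thesis .
      qed
      finally show "ereal (partition_entropy M (dyn_refinement M f P n) / real n) \<le> ereal (?b n)"
        by simp
    qed
    also have "\<dots> = ereal (?H / real m + \<epsilon>)"
    proof (rule lim_imp_Limsup)
      have "?b \<longlonglongrightarrow> ?H / real m + \<epsilon> + (real k / real m + 1) * ?H * 0"
        by (intro tendsto_intros lim_inverse_n)
      then show "(\<lambda>n. ereal (?b n)) \<longlonglongrightarrow> ereal (?H / real m + \<epsilon>)" by simp
    qed simp
    finally show "limsup (\<lambda>n. ereal (partition_entropy M (dyn_refinement M f P n) / real n)) \<le>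
        ereal (?H / real m) + ereal \<epsilon>" by simp
  qed
qed

end

text \<open>Approximable sets are closed under complement and countable union, so open sets suffice.
  Within \<open>G\<close> an open set is the union over \<open>k\<close> of the cylinders of those
  words of length \<open>k\<close> that points of \<open>G\<close> show only inside it. This union
  runs over lengths and is countable without a countable base.\<close>

lemma cylinder_approximable_borel:
  fixes M :: "'a::topological_space measure" and X :: "'a \<Rightarrow> 'b"
  assumes prob_M: "prob_space M" and f_meas: "f \<in> measurable M M" 
    and X: "simple_function M X" and sets_M: "sets M = sets borel"
    and G: "AE x in M. x \<in> G"
    and sep: "\<And>U x. open U \<Longrightarrow> x \<in> U \<Longrightarrow> x \<in> G \<Longrightarrow>
      \<exists>k. \<forall>y\<in>G. itinerary f X k y = itinerary f X k x \<longrightarrow> y \<in> U"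
    and A: "A \<in> sets M"
  shows "cylinder_approximable M f X A"
proof -
  note facts = prob_M f_meas X
  have sp: "space M = UNIV" using sets_eq_imp_space_eq[OF sets_M] by simp
  have "A \<in> sigma_sets UNIV {S. open S}"
    using A sets_M by (simp add: borel_def)
  then show ?thesis
  proof (induction rule: sigma_sets.induct)
    case (Basic U)
    then have U: "open U" by simp
    define B where "B k = {c. \<forall>y\<in>G. itinerary f X k y = c \<longrightarrow> y \<in> U}" for k
    have "cylinder_approximable M f X (\<Union>k. cylinder_set M f X k (B k))"
      by (intro cylinder_approximable_UN[OF facts] cylinder_approximable_cylinder_set[OF facts])
    then show ?case
    proof (rule cylinder_approximable_AE[OF facts])
      show "U \<in> sets M" using U sets_M by simp
      show "AE x in M. x \<in> (\<Union>k. cylinder_set M f X k (B k)) \<longleftrightarrow> x \<in> U"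
        using G
      proof eventually_elim
        case (elim x)
        then show ?case using sep[OF U, of x] by (auto simp: cylinder_set_def B_def sp)
      qed
    qed
  next
    case Empty
    show ?case
      using cylinder_approximable_cylinder_set[OF facts, of 0 "{}"] by (simp add: cylinder_set_def)
  next
    case (Compl A)
    then show ?case using cylinder_approximable_compl[OF facts, of A] sp by simp
  next
    case (Union A)
    show ?case by (rule cylinder_approximable_UN[OF facts Union.IH])
  qed
qed

section \<open>The projective line and the squaring coordinate\<close>

lemma cp1_cases:
  obtains x y where "(x, y) \<noteq> 0" "z = cp1_pt x y"
  using rep_cp1_nonzero[of z] cp1_pt_rep[of z] by (metis prod.collapse)

lemma rep_cp1_pt:
  assumes "(x, y) \<noteq> 0"
  obtains c where "c \<noteq> 0" "rep_cp1 (cp1_pt x y) = (c * x, c * y)"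
proof -
  obtain x' y' where xy: "rep_cp1 (cp1_pt x y) = (x', y')" by fastforce
  then have "(x', y') \<noteq> 0" "cp1_pt x y = cp1_pt x' y'"
    using rep_cp1_nonzero[of "cp1_pt x y"] cp1_pt_rep[of "cp1_pt x y"] by auto
  then show thesis using cp1_pt_eq_iff[OF assms, of x' y'] xy that by auto
qed

lemma cp1_pt_scale:
  assumes "(x, y) \<noteq> 0" "c \<noteq> 0"
  shows "cp1_pt (c * x) (c * y) = cp1_pt x y"
  using cp1_pt_eq_iff[OF assms(1), of "c * x" "c * y"] assms by (auto simp: zero_prod_def)

text \<open>Scale invariance makes the choice hidden in \<open>rep_cp1\<close> immaterial: any
  representative may be used for evaluation.\<close>

lemma rep_cp1_lift:
  assumes "\<And>c x y. c \<noteq> 0 \<Longrightarrow> (x, y) \<noteq> 0 \<Longrightarrow> H (c * x, c * y) = H (x, y)"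
    and "(x, y) \<noteq> 0"
  shows "H (rep_cp1 (cp1_pt x y)) = H (x, y)"
  using rep_cp1_pt[OF assms(2)] assms by metis

lemma cp1_pt_eq_infinity_iff: "(x, y) \<noteq> 0 \<Longrightarrow> cp1_pt x y = cp1_infinity \<longleftrightarrow> y = 0"
  unfolding cp1_infinity_def
  by (subst cp1_pt_eq_iff) (auto simp: zero_prod_def intro!: exI[of _ "inverse x"])

lemma open_cp1_lift:
  assumes "\<And>c x y. c \<noteq> 0 \<Longrightarrow> (x, y) \<noteq> 0 \<Longrightarrow> P (c * x, c * y) = P (x, y)"
    and "open {v. v \<noteq> 0 \<and> P v}"
  shows "open {z. P (rep_cp1 z)}"
proof -
  have "P (rep_cp1 (abs_cp1 v)) = P v" if "v \<noteq> 0" for v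
    using rep_cp1_lift[of P "fst v" "snd v", OF assms(1)] that by (simp add: cp1_pt_def)
  then have "{v. v \<noteq> 0 \<and> abs_cp1 v \<in> {z. P (rep_cp1 z)}} = {v. v \<noteq> 0 \<and> P v}" by auto
  then show ?thesis using assms(2) by (simp add: open_cp1_def)
qed

lemma open_nonzero_vimage:
  fixes H :: "'a::{t1_space, zero} \<Rightarrow> 'b::topological_space"
  assumes "continuous_on (- {0}) H" "open B"
  shows "open {v. v \<noteq> 0 \<and> H v \<in> B}"
proof -
  have "open (H -` B \<inter> (- {0}))"
    using assms continuous_on_open_vimage[of "- {0}" H] by blast
  moreover have "H -` B \<inter> (- {0}) = {v. v \<noteq> 0 \<and> H v \<in> B}" by auto
  ultimately show ?thesis by simp
qed

text \<open>The line is a quotient of the punctured plane, so scale invariant functions that are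
  continuous there descend. The Newton map, \<open>ratio\<close> and \<open>depth\<close> obtain
  their continuity in this way.\<close>

lemma continuous_on_cp1_lift:
  fixes H :: "complex \<times> complex \<Rightarrow> 'b::topological_space"
  assumes "\<And>c x y. c \<noteq> 0 \<Longrightarrow> (x, y) \<noteq> 0 \<Longrightarrow> H (c * x, c * y) = H (x, y)"
    and "continuous_on (- {0}) H"
  shows "continuous_on UNIV (\<lambda>z. H (rep_cp1 z))"
  unfolding continuous_on_open_vimage[OF open_UNIV]
proof (intro allI impI)
  fix B :: "'b set" assume B: "open B"
  have "open {z. H (rep_cp1 z) \<in> B}"
    by (rule open_cp1_lift[of "\<lambda>v. H v \<in> B"]) (use assms open_nonzero_vimage[OF _ B] in auto)
  then show "open ((\<lambda>z. H (rep_cp1 z)) -` B \<inter> UNIV)" by (simp add: vimage_def)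
qed

lemma continuous_on_abs_cp1:
  "continuous_on (- {0}) abs_cp1"
proof -
  have "open (abs_cp1 -` B \<inter> - {0})" if "open B" for B
  proof -
    have "abs_cp1 -` B \<inter> - {0} = {v. v \<noteq> 0 \<and> abs_cp1 v \<in> B}" by auto
    then show ?thesis using that by (simp add: open_cp1_def)
  qed
  then show ?thesis
    by (subst continuous_on_open_vimage) (auto intro: open_Compl)
qed

text \<open>
  \<open>w = u / v\<close> is the coordinate \<open>(z - a) / (z - b)\<close>, in which the Newton map of
  \<open>(z - a) (z - b)\<close> becomes \<open>w \<mapsto> w\<^sup>2\<close>; it is kept in the homogeneous form \<open>[u : v]\<close>.
\<close>

definition moebius_pt :: "complex \<Rightarrow> complex \<Rightarrow> complex \<Rightarrow> complex \<Rightarrow> cp1" where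
  "moebius_pt a b u v = cp1_pt (a * v - b * u) (v - u)"

definition moebius_coord :: "complex \<Rightarrow> complex \<Rightarrow> complex \<times> complex \<Rightarrow> complex \<times> complex" where
  "moebius_coord a b p = (fst p - a * snd p, fst p - b * snd p)"

lemma moebius_coord_scale:
  "moebius_coord a b (c * x, c * y) =
     (c * fst (moebius_coord a b (x, y)), c * snd (moebius_coord a b (x, y)))"
  by (simp add: moebius_coord_def algebra_simps)

lemma moebius_coord_continuous [continuous_intros]:
  "continuous_on S (moebius_coord a b)"
  unfolding moebius_coord_def by (intro continuous_intros)

lemma Im_mult_cnj_scale: "Im (c * u * cnj (c * v)) = (norm c)\<^sup>2 * Im (u * cnj v)"
  by (simp add: cmod_power2) (simp add: power2_eq_square algebra_simps)

text \<open>Only the conjugacy with squaring is recorded, not the polynomial, which keeps the bound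
  for the mass of a cylinder uniform in \<open>a\<close> and \<open>b\<close>.\<close>

locale quadratic_newton =
  fixes a b :: complex and f :: "cp1 \<Rightarrow> cp1"
  assumes neq: "a \<noteq> b"
    and f_moebius_pt: "(u, v) \<noteq> 0 \<Longrightarrow> f (moebius_pt a b u v) = moebius_pt a b (u\<^sup>2) (v\<^sup>2)"
begin

abbreviation "pt \<equiv> moebius_pt a b"
abbreviation "co \<equiv> moebius_coord a b"

lemma co_nonzero: "p \<noteq> 0 \<Longrightarrow> co p \<noteq> 0"
  using neq by (cases p) (auto simp: moebius_coord_def zero_prod_def)

lemma pt_nonzero: "(u, v) \<noteq> 0 \<Longrightarrow> (a * v - b * u, v - u) \<noteq> 0"
  using neq by (auto simp: zero_prod_def left_diff_distrib[symmetric])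

lemma co_pt: "co (a * v - b * u, v - u) = ((a - b) * u, (a - b) * v)"
  by (simp add: moebius_coord_def algebra_simps)

lemma pt_co: "(x, y) \<noteq> 0 \<Longrightarrow> pt (fst (co (x, y))) (snd (co (x, y))) = cp1_pt x y"
  using cp1_pt_scale[of x y "a - b"] neq
  by (simp add: moebius_pt_def moebius_coord_def algebra_simps)

lemma pt_scale: "(u, v) \<noteq> 0 \<Longrightarrow> c \<noteq> 0 \<Longrightarrow> pt (c * u) (c * v) = pt u v"
  using cp1_pt_scale[OF pt_nonzero, of u v c] by (simp add: moebius_pt_def algebra_simps)

lemma pt_cases:
  obtains u v where "(u, v) \<noteq> 0" "z = pt u v"
  by (metis cp1_cases pt_co co_nonzero prod.collapse)

text \<open>The coordinates of \<open>pt u v\<close> return \<open>(u, v)\<close> up to the factor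
  \<open>a - b\<close> and the scalar chosen by \<open>rep_cp1\<close>; invariance of
  \<open>H\<close> absorbs both.\<close>

lemma lift_co_pt:
  assumes "\<And>c u v. c \<noteq> 0 \<Longrightarrow> (u, v) \<noteq> 0 \<Longrightarrow> H (c * u, c * v) = H (u, v)" "(u, v) \<noteq> 0"
  shows "H (co (rep_cp1 (pt u v))) = H (u, v)"
proof -
  have "H (co (rep_cp1 (pt u v))) = H (co (a * v - b * u, v - u))"
    unfolding moebius_pt_def
  proof (rule rep_cp1_lift[of "\<lambda>p. H (co p)"])
    fix c x y :: complex assume "c \<noteq> 0" "(x, y) \<noteq> 0"
    then show "H (co (c * x, c * y)) = H (co (x, y))"
      using assms(1)[of c "fst (co (x, y))" "snd (co (x, y))"] co_nonzero[of "(x, y)"]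
      by (simp add: moebius_coord_scale)
  qed (rule pt_nonzero[OF assms(2)])
  also have "\<dots> = H (u, v)"
    unfolding co_pt using neq assms by simp
  finally show ?thesis .
qed

lemma open_lift_co:
  assumes "\<And>c u v. c \<noteq> 0 \<Longrightarrow> (u, v) \<noteq> 0 \<Longrightarrow> P (c * u, c * v) = P (u, v)" "open {p. P p}"
  shows "open {z. P (co (rep_cp1 z))}"
proof (rule open_cp1_lift[of "\<lambda>p. P (co p)"])
  fix c x y :: complex assume "c \<noteq> 0" "(x, y) \<noteq> 0"
  then show "P (co (c * x, c * y)) = P (co (x, y))"
    using assms(1)[of c "fst (co (x, y))" "snd (co (x, y))"] co_nonzero[of "(x, y)"]
    by (simp add: moebius_coord_scale)
next
  have "open (co -` {p. P p})"
    using assms(2) by (intro open_vimage continuous_intros)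
  then have "open (- {0} \<inter> co -` {p. P p})" by (intro open_Int) auto
  then show "open {v. v \<noteq> 0 \<and> P (co v)}"
    by (rule back_subst[where P = "open"]) auto
qed

text \<open>In homogeneous coordinates \<open>f\<close> is a pair of quadratic forms without common
  zero. The measurability of \<open>f\<close> required for \<open>circ_measure\<close> comes from
  here.\<close>

lemma f_continuous: "continuous_on UNIV f"
proof -
  define H where "H p = abs_cp1 (a * (snd (co p))\<^sup>2 - b * (fst (co p))\<^sup>2, (snd (co p))\<^sup>2 - (fst (co p))\<^sup>2)" for p
  have H: "H (x, y) = f (cp1_pt x y)" if "(x, y) \<noteq> 0" for x y
    using that f_moebius_pt[of "fst (co (x, y))" "snd (co (x, y))"] co_nonzero[OF that] pt_co[OF that]
    by (simp add: H_def moebius_pt_def cp1_pt_def)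
  have "continuous_on (- {0}) H"
    unfolding H_def
  proof (rule continuous_on_compose2[OF continuous_on_abs_cp1])
    show "continuous_on (- {0}) (\<lambda>p. (a * (snd (co p))\<^sup>2 - b * (fst (co p))\<^sup>2, (snd (co p))\<^sup>2 - (fst (co p))\<^sup>2))"
      by (intro continuous_intros)
    show "(\<lambda>p. (a * (snd (co p))\<^sup>2 - b * (fst (co p))\<^sup>2, (snd (co p))\<^sup>2 - (fst (co p))\<^sup>2)) ` (- {0}) \<subseteq> - {0}"
    proof clarify
      fix x y :: complex
      assume nz: "(x, y) \<noteq> 0"
        and z: "(a * (snd (co (x, y)))\<^sup>2 - b * (fst (co (x, y)))\<^sup>2, (snd (co (x, y)))\<^sup>2 - (fst (co (x, y)))\<^sup>2) = 0"
      have "((fst (co (x, y)))\<^sup>2, (snd (co (x, y)))\<^sup>2) \<noteq> 0"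
        using co_nonzero[OF nz] by (auto simp: zero_prod_def prod_eq_iff)
      from pt_nonzero[OF this] z show False by simp
    qed
  qed
  then have "continuous_on UNIV (\<lambda>z. H (rep_cp1 z))"
    by (rule continuous_on_cp1_lift[rotated]) (auto simp: H cp1_pt_scale zero_prod_def)
  moreover have "(\<lambda>z. H (rep_cp1 z)) = f"
  proof
    fix z
    show "H (rep_cp1 z) = f z"
      using H[of "fst (rep_cp1 z)" "snd (rep_cp1 z)"] rep_cp1_nonzero[of z] cp1_pt_rep[of z] by simp
  qed
  ultimately show ?thesis by (simp only:)
qed

text \<open>The half circles get the symbols 0 and 1, the two attracting basins the symbols 2 and 3.\<close>

definition symb_fun :: "complex \<times> complex \<Rightarrow> nat" where
  "symb_fun p = (if norm (fst p) < norm (snd p) then 2 else if norm (snd p) < norm (fst p) then 3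
     else if Im (fst p * cnj (snd p)) > 0 \<or> fst p = snd p then 0 else 1)"

definition symb :: "cp1 \<Rightarrow> nat" where
  "symb z = symb_fun (co (rep_cp1 z))"

lemma symb_fun_scale:
  assumes "c \<noteq> 0"
  shows "symb_fun (c * u, c * v) = symb_fun (u, v)"
proof -
  have "Im (c * u * cnj (c * v)) = (norm c)\<^sup>2 * Im (u * cnj v)" by (rule Im_mult_cnj_scale)
  then have "Im (c * u * cnj (c * v)) > 0 \<longleftrightarrow> Im (u * cnj v) > 0"
    using assms by (simp add: zero_less_mult_iff)
  then show ?thesis using assms unfolding symb_fun_def by (simp add: norm_mult)
qed

lemma symb_pt: "(u, v) \<noteq> 0 \<Longrightarrow> symb (pt u v) = symb_fun (u, v)"
  unfolding symb_def by (rule lift_co_pt) (simp_all add: symb_fun_scale)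

lemma symb_less: "symb z < 4"
  by (simp add: symb_def symb_fun_def)

lemma symb_simple_function:
  fixes M :: "cp1 measure"
  assumes "sets M = sets borel"
  shows "simple_function M symb"
proof -
  have sp: "space M = UNIV" using sets_eq_imp_space_eq[OF assms] by simp
  have o: "{z. P (co (rep_cp1 z))} \<in> sets borel"
    if "\<And>c u v. c \<noteq> 0 \<Longrightarrow> (u, v) \<noteq> 0 \<Longrightarrow> P (c * u, c * v) = P (u, v)" "open {p. P p}" for P
    using open_lift_co[OF that] by simp
  have s2: "{z. norm (fst (co (rep_cp1 z))) < norm (snd (co (rep_cp1 z)))} \<in> sets borel"
    by (rule o[of "\<lambda>p. norm (fst p) < norm (snd p)"])
       (auto simp: norm_mult intro!: open_Collect_less continuous_intros)
  have s3: "{z. norm (snd (co (rep_cp1 z))) < norm (fst (co (rep_cp1 z)))} \<in> sets borel"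
    by (rule o[of "\<lambda>p. norm (snd p) < norm (fst p)"])
       (auto simp: norm_mult intro!: open_Collect_less continuous_intros)
  have s01: "{z. fst (co (rep_cp1 z)) \<noteq> snd (co (rep_cp1 z))} \<in> sets borel"
    by (rule o[of "\<lambda>p. fst p \<noteq> snd p"])
       (auto intro!: open_Collect_neq continuous_intros)
  have im: "Im (c * u * cnj (c * v)) > 0 \<longleftrightarrow> Im (u * cnj v) > 0" if "c \<noteq> 0" for c u v
  proof -
    have "Im (c * u * cnj (c * v)) = (norm c)\<^sup>2 * Im (u * cnj v)" by (rule Im_mult_cnj_scale)
    then show ?thesis using that by (simp add: zero_less_mult_iff)
  qed
  have s0: "{z. Im (fst (co (rep_cp1 z)) * cnj (snd (co (rep_cp1 z)))) > 0} \<in> sets borel"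
    by (rule o[of "\<lambda>p. Im (fst p * cnj (snd p)) > 0"])
       (use im in \<open>auto intro!: open_Collect_less continuous_intros\<close>)
  have su: "{z. Im (fst (co (rep_cp1 z)) * cnj (snd (co (rep_cp1 z)))) > 0 \<or>
      fst (co (rep_cp1 z)) = snd (co (rep_cp1 z))} \<in> sets borel"
    using sets.Un[OF s0 borel_comp[OF s01]]
    by (rule back_subst[where P = "\<lambda>S. S \<in> sets borel"]) blast
  have "symb \<in> measurable borel (count_space UNIV)"
    unfolding symb_def symb_fun_def
    using s2 s3 su by (intro measurable_If measurable_const) simp_all
  then have "symb \<in> measurable M (count_space UNIV)"
    using measurable_cong_sets[OF assms refl, of "count_space UNIV"] by blast
  then have "symb -` {i} \<inter> space M \<in> sets M" for i
    by (rule measurable_sets) simp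
  moreover have "finite (symb ` space M)"
    by (rule finite_subset[of _ "{..<4}"]) (use symb_less in auto)
  ultimately show ?thesis by (simp add: simple_function_def)
qed

end

section \<open>Masses of cylinders\<close>

lemma floor_double: "\<lfloor>2 * x\<rfloor> = 2 * \<lfloor>x\<rfloor> + (if frac x < 1 / 2 then 0 else 1)" for x :: real
proof (cases "frac x < 1 / 2")
  case True
  have "0 \<le> frac x" by (rule frac_ge_0)
  with True show ?thesis by (intro floor_unique) (auto simp: frac_def)
next
  case False
  have "frac x < 1" by (rule frac_lt_1)
  with False show ?thesis by (intro floor_unique) (auto simp: frac_def)
qed

text \<open>The test \<open>frac (2 ^ i * x) < 1 / 2\<close> reads one binary digit of
  \<open>x\<close>, and each further digit refines the floor by \<open>floor_double\<close>.\<close>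

lemma binary_digits_eq_iff:
  fixes x y :: real
  assumes "\<lfloor>x\<rfloor> = \<lfloor>y\<rfloor>"
  shows "(\<forall>i<n. frac (2 ^ i * x) < 1 / 2 \<longleftrightarrow> frac (2 ^ i * y) < 1 / 2) \<longleftrightarrow> \<lfloor>2 ^ n * x\<rfloor> = \<lfloor>2 ^ n * y\<rfloor>"
proof (induction n)
  case 0
  show ?case using assms by simp
next
  case (Suc n)
  have fl: "\<lfloor>2 ^ Suc n * z\<rfloor> = 2 * \<lfloor>2 ^ n * z\<rfloor> + (if frac (2 ^ n * z) < 1 / 2 then 0 else 1)" for z :: real
    using floor_double[of "2 ^ n * z"] by (simp add: mult.assoc)
  have "(\<forall>i<Suc n. frac (2 ^ i * x) < 1 / 2 \<longleftrightarrow> frac (2 ^ i * y) < 1 / 2) \<longleftrightarrow>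
      \<lfloor>2 ^ n * x\<rfloor> = \<lfloor>2 ^ n * y\<rfloor> \<and> (frac (2 ^ n * x) < 1 / 2 \<longleftrightarrow> frac (2 ^ n * y) < 1 / 2)"
    using Suc by (auto simp: less_Suc_eq)
  also have "\<dots> \<longleftrightarrow> \<lfloor>2 ^ Suc n * x\<rfloor> = \<lfloor>2 ^ Suc n * y\<rfloor>"
    unfolding fl by (cases "frac (2 ^ n * x) < 1 / 2"; cases "frac (2 ^ n * y) < 1 / 2") presburger+
  finally show ?case .
qed

text \<open>With \<open>s = 1 - ?q v\<close>, the cell of \<open>v\<close> costs at most
  \<open>s\<close> and the others, of total mass \<open>s\<close>, at most
  \<open>1 - s + s * ln (real K)\<close>. A heavy cell thus forfeits entropy in proportion to
  \<open>ln (real K)\<close>.\<close>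

lemma (in prob_space) rv_entropy_le_card:
  assumes X: "simple_function M X" and v: "v \<in> X ` space M"
    and K: "card (X ` space M) \<le> K + 1" "0 < K"
  shows "rv_entropy M X \<le> 1 + (1 - prob (X -` {v} \<inter> space M)) * ln (real K)"
proof -
  let ?q = "\<lambda>w. prob (X -` {w} \<inter> space M)"
  define S where "S = X ` space M - {v}"
  define s where "s = (\<Sum>w\<in>S. ?q w)"
  have fin: "finite (X ` space M)" using X by (simp add: simple_function_def)
  have "(\<Sum>w\<in>X ` space M. ?q w) = prob (\<Union>w\<in>X ` space M. X -` {w} \<inter> space M)"
    by (rule finite_measure_finite_Union[symmetric])
       (use X fin in \<open>auto simp: disjoint_family_on_def simple_function_def\<close>)
  also have "(\<Union>w\<in>X ` space M. X -` {w} \<inter> space M) = space M" by auto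
  finally have ps: "?q v + s = 1"
    using sum.remove[OF fin v, of ?q] by (simp add: prob_space s_def S_def)
  have s0: "0 \<le> s" unfolding s_def by (intro sum_nonneg) simp
  have "card S = card (X ` space M) - 1" using v fin by (simp add: S_def)
  then have cS: "card S \<le> K" using K by simp
  have "(\<Sum>w\<in>S. - (?q w * ln (?q w))) \<le> 1 - s + s * ln (real K)"
  proof (cases "s = 0")
    case True
    then have "?q w = 0" if "w \<in> S" for w
      using that fin unfolding s_def by (subst (asm) sum_nonneg_eq_0_iff) (auto simp: S_def)
    then show ?thesis using True by simp
  next
    case False
    then have sp: "0 < s" using s0 by simp
    \<comment> \<open>Uniform distribution of the remaining mass over \<open>K\<close> cells: in the
      summed Gibbs inequality \<open>real K * u\<close> cancels \<open>s\<close>.\<close>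
    define u where "u = s / real K"
    have u: "0 < u" "real K * u = s" using sp K by (simp_all add: u_def)
    have "(\<Sum>w\<in>S. - (?q w * ln (?q w))) \<le> (\<Sum>w\<in>S. u - ?q w - ?q w * ln u)"
      using u by (intro sum_mono neg_mult_ln_le_diff) auto
    also have "\<dots> = real (card S) * u - s - s * ln u"
      by (simp add: sum_subtractf s_def sum_distrib_right)
    also have "\<dots> \<le> real K * u - s - s * ln u" using cS u(1) by (simp add: mult_right_mono)
    also have "\<dots> = - (s * ln s) + s * ln (real K)"
      using u sp K by (simp add: u_def ln_div algebra_simps)
    also have "\<dots> \<le> 1 - s + s * ln (real K)"
      using neg_mult_ln_le_diff[of s 1] s0 by simp
    finally show ?thesis .
  qed
  moreover have "- (?q v * ln (?q v)) \<le> 1 - ?q v"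
    using neg_mult_ln_le_diff[of "?q v" 1] by simp
  moreover have "rv_entropy M X = - (?q v * ln (?q v)) + (\<Sum>w\<in>S. - (?q w * ln (?q w)))"
    unfolding rv_entropy_def S_def using sum.remove[OF fin v, of "\<lambda>w. ?q w * ln (?q w)"]
    by (simp add: sum_negf)
  moreover have s: "1 - ?q v = s" using ps by simp
  ultimately show ?thesis unfolding s by linarith
qed

section \<open>Symbolic dynamics of squaring on the circle\<close>

context quadratic_newton
begin

text \<open>The angle is measured in full turns, so that \<open>f\<close> becomes doubling modulo
  1.\<close>

definition circ :: "real \<Rightarrow> cp1" where
  "circ \<theta> = pt (cis (2 * pi * \<theta>)) 1"

lemma f_circ: "f (circ \<theta>) = circ (2 * \<theta>)"
  unfolding circ_def by (subst f_moebius_pt) (simp_all add: zero_prod_def power2_eq_square cis_mult)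

lemma funpow_f_circ: "(f ^^ i) (circ \<theta>) = circ (2 ^ i * \<theta>)"
  by (induction i) (simp_all add: f_circ mult.assoc)

lemma circ_continuous: "continuous_on UNIV circ"
proof -
  have eq: "circ = (\<lambda>\<theta>. abs_cp1 (a * 1 - b * cis (2 * pi * \<theta>), 1 - cis (2 * pi * \<theta>)))"
    by (simp add: fun_eq_iff circ_def moebius_pt_def cp1_pt_def)
  show ?thesis unfolding eq
  proof (rule continuous_on_compose2[OF continuous_on_abs_cp1])
    show "continuous_on UNIV (\<lambda>\<theta>. (a * 1 - b * cis (2 * pi * \<theta>), 1 - cis (2 * pi * \<theta>)))"
      by (intro continuous_intros)
    show "range (\<lambda>\<theta>. (a * 1 - b * cis (2 * pi * \<theta>), 1 - cis (2 * pi * \<theta>))) \<subseteq> - {0}"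
      using pt_nonzero[of "cis (2 * pi * _)" 1] by (auto simp: zero_prod_def)
  qed
qed

lemma cis_frac: "cis (2 * pi * \<theta>) = cis (2 * pi * frac \<theta>)"
proof -
  have "cis (2 * pi * \<theta>) = cis (2 * pi * frac \<theta>) * cis (2 * pi * of_int \<lfloor>\<theta>\<rfloor>)"
    by (simp add: cis_mult frac_def algebra_simps)
  then show ?thesis by simp
qed

lemma circ_frac: "circ \<theta> = circ (frac \<theta>)"
  unfolding circ_def by (subst cis_frac) (rule refl)

text \<open>The half circles are half open: \<open>w = 1\<close> gets symbol 0 and
  \<open>w = - 1\<close> symbol 1, so that symbols match binary digits without exceptional
  points.\<close>

lemma symb_circ: "symb (circ \<theta>) = (if frac \<theta> < 1 / 2 then 0 else 1)"
proof -
  define t where "t = frac \<theta>"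
  have t: "0 \<le> t" "t < 1" unfolding t_def by (rule frac_ge_0, rule frac_lt_1)
  have "symb (circ \<theta>) = symb_fun (cis (2 * pi * t), 1)"
    unfolding circ_def t_def by (subst cis_frac, rule symb_pt) (simp add: zero_prod_def)
  also have "\<dots> = (if sin (2 * pi * t) > 0 \<or> cis (2 * pi * t) = 1 then 0 else 1)"
    by (simp add: symb_fun_def)
  also have "\<dots> = (if t < 1 / 2 then 0 else 1)"
  proof -
    consider "t = 0" | "0 < t" "t < 1 / 2" | "t = 1 / 2" | "1 / 2 < t" using t by linarith
    then show ?thesis
    proof cases
      case 2
      have "0 < sin (2 * pi * t)" by (rule sin_gt_zero) (use 2 in auto)
      then show ?thesis using 2 by simp
    next
      case 4
      have "sin (2 * pi * t) < 0" by (rule sin_lt_zero) (use 4 t in auto)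
      then show ?thesis using 4 by (auto simp: complex_eq_iff)
    next
      case 3
      then have "2 * pi * t = pi" by simp
      then have "sin (2 * pi * t) = 0" "cos (2 * pi * t) = - 1" by (simp_all only: sin_pi cos_pi)
      moreover have "\<not> t < 1 / 2" using 3 by simp
      ultimately show ?thesis by (simp add: complex_eq_iff)
    qed simp
  qed
  finally show ?thesis by (simp add: t_def)
qed

text \<open>Cylinders on the circle are dyadic arcs, since symbols are binary digits. This serves
  the separation of points, the entropy of Lebesgue measure and the count of cells that meet a short
  arc.\<close>

lemma itinerary_circ_eq_iff:
  assumes "\<lfloor>x\<rfloor> = \<lfloor>y\<rfloor>"
  shows "itinerary f symb n (circ x) = itinerary f symb n (circ y) \<longleftrightarrow> \<lfloor>2 ^ n * x\<rfloor> = \<lfloor>2 ^ n * y\<rfloor>"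
proof -
  have "symb ((f ^^ i) (circ x)) = symb ((f ^^ i) (circ y)) \<longleftrightarrow>
      (frac (2 ^ i * x) < 1 / 2 \<longleftrightarrow> frac (2 ^ i * y) < 1 / 2)" for i
    by (simp add: funpow_f_circ symb_circ)
  then show ?thesis
    using binary_digits_eq_iff[OF assms, of n] by (simp add: itinerary_eq_iff)
qed

lemma symb_circle:
  assumes "symb z < 2"
  obtains \<theta> where "0 \<le> \<theta>" "\<theta> < 1" "z = circ \<theta>"
proof -
  obtain u v where uv: "(u, v) \<noteq> 0" "z = pt u v" by (rule pt_cases)
  then have n: "norm u = norm v"
    using assms by (auto simp: symb_pt symb_fun_def split: if_splits)
  then have v: "v \<noteq> 0" using uv by (auto simp: zero_prod_def)
  have "z = pt (v * (u / v)) (v * 1)" using uv v by simp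
  also have "\<dots> = pt (u / v) 1" by (rule pt_scale) (use v in \<open>auto simp: zero_prod_def\<close>)
  finally have z: "z = pt (u / v) 1" .
  have "norm (u / v) = 1" using n v by (simp add: norm_divide)
  then have w: "u / v = cis (Arg2pi (u / v))"
    using complex_norm_eq_1_exp[of "u / v"] by (simp add: cis_conv_exp)
  show thesis
  proof (rule that)
    show "0 \<le> Arg2pi (u / v) / (2 * pi)" by (simp add: Arg2pi_ge_0)
    show "Arg2pi (u / v) / (2 * pi) < 1" by (simp add: Arg2pi_lt_2pi)
    show "z = circ (Arg2pi (u / v) / (2 * pi))"
      unfolding circ_def by (subst z, subst w) simp
  qed
qed

text \<open>Squaring preserves the order of \<open>norm u\<close> and \<open>norm v\<close>.\<close>

lemma symb_f:
  shows "symb z < 2 \<Longrightarrow> symb (f z) < 2" "symb z = 2 \<Longrightarrow> symb (f z) = 2" "symb z = 3 \<Longrightarrow> symb (f z) = 3"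
proof -
  obtain u v where uv: "(u, v) \<noteq> 0" "z = pt u v" by (rule pt_cases)
  have "(u\<^sup>2, v\<^sup>2) \<noteq> 0" using uv by (auto simp: zero_prod_def)
  then have fz: "symb (f z) = symb_fun (u\<^sup>2, v\<^sup>2)" using uv by (simp add: f_moebius_pt symb_pt)
  have z: "symb z = symb_fun (u, v)" using uv by (simp add: symb_pt)
  have iff: "norm (x\<^sup>2) < norm (y\<^sup>2) \<longleftrightarrow> norm x < norm y" for x y :: complex
    by (simp only: norm_power) (auto intro: power_strict_mono power_less_imp_less_base)
  show "symb z < 2 \<Longrightarrow> symb (f z) < 2" "symb z = 2 \<Longrightarrow> symb (f z) = 2" "symb z = 3 \<Longrightarrow> symb (f z) = 3"
    unfolding fz z symb_fun_def fst_conv snd_conv iff by (auto split: if_splits)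
qed

lemma symb_funpow_f:
  shows "symb z < 2 \<Longrightarrow> symb ((f ^^ i) z) < 2" "symb z = 2 \<Longrightarrow> symb ((f ^^ i) z) = 2"
    "symb z = 3 \<Longrightarrow> symb ((f ^^ i) z) = 3"
  by (induction i) (simp_all add: symb_f)

text \<open>On the circle words are binary; off it the symbol never changes, so the two basins add
  just two constant words.\<close>

lemma card_itinerary: "card (range (itinerary f symb n)) \<le> 2 ^ n + 2"
proof -
  let ?L = "{l. set l \<subseteq> {0, 1::nat} \<and> length l = n}"
  have "range (itinerary f symb n) \<subseteq> ?L \<union> {replicate n 2, replicate n 3}"
  proof clarify
    fix z assume nr: "itinerary f symb n z \<noteq> replicate n 3" "itinerary f symb n z \<notin> {}"
      "itinerary f symb n z \<noteq> replicate n 2"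
    have "symb z \<noteq> 2" "symb z \<noteq> 3"
      using nr symb_funpow_f(2,3)[of z] by (auto simp: list_eq_iff_nth_eq nth_itinerary)
    then have "symb z < 2" using symb_less[of z] by simp
    from symb_funpow_f(1)[OF this]
    show "set (itinerary f symb n z) \<subseteq> {0, 1} \<and> length (itinerary f symb n z) = n"
      by (force simp: itinerary_def less_2_cases_iff)
  qed
  then have "card (range (itinerary f symb n)) \<le> card (?L \<union> {replicate n 2, replicate n 3})"
    by (rule card_mono[rotated]) (simp add: finite_lists_length_eq)
  also have "\<dots> \<le> card ?L + card {replicate n (2::nat), replicate n 3}" by (rule card_Un_le)
  also have "card {replicate n (2::nat), replicate n 3} \<le> 2" by (simp add: card_insert_if)
  also have "card ?L = 2 ^ n"
    using card_lists_length_eq[of "{0, 1::nat}" n] by (simp add: numeral_2_eq_2)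
  finally show ?thesis by simp
qed

text \<open>This is min(|w|, 1/|w|) for \<open>w = u / v\<close>: it is 1 on the circle and 0 at the
  two attracting fixed points.\<close>

definition ratio_fun :: "complex \<times> complex \<Rightarrow> real" where
  "ratio_fun p = min (norm (fst p)) (norm (snd p)) / max (norm (fst p)) (norm (snd p))"

definition ratio :: "cp1 \<Rightarrow> real" where
  "ratio z = ratio_fun (co (rep_cp1 z))"

lemma ratio_fun_scale: "c \<noteq> 0 \<Longrightarrow> ratio_fun (c * u, c * v) = ratio_fun (u, v)"
  by (auto simp: ratio_fun_def norm_mult min_def max_def)

lemma ratio_pt: "(u, v) \<noteq> 0 \<Longrightarrow> ratio (pt u v) = ratio_fun (u, v)"
  unfolding ratio_def by (rule lift_co_pt) (simp_all add: ratio_fun_scale)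

lemma ratio_f: "ratio (f z) = (ratio z)\<^sup>2"
proof -
  obtain u v where uv: "(u, v) \<noteq> 0" "z = pt u v" by (rule pt_cases)
  have "(u\<^sup>2, v\<^sup>2) \<noteq> 0" using uv by (auto simp: zero_prod_def)
  then have "ratio (f z) = ratio_fun (u\<^sup>2, v\<^sup>2)" using uv by (simp add: f_moebius_pt ratio_pt)
  also have "\<dots> = (ratio_fun (u, v))\<^sup>2"
  proof (cases "norm u \<le> norm v")
    case True
    then have "(norm u)\<^sup>2 \<le> (norm v)\<^sup>2" by (simp add: power_mono)
    then show ?thesis using True
      by (simp add: ratio_fun_def norm_power power_divide min_absorb1 max_absorb2)
  next
    case False
    then have "(norm v)\<^sup>2 \<le> (norm u)\<^sup>2" by (simp add: power_mono)
    then show ?thesis using False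
      by (simp add: ratio_fun_def norm_power power_divide min_absorb2 max_absorb1)
  qed
  finally show ?thesis using uv by (simp add: ratio_pt)
qed

lemma ratio_bounds: "0 \<le> ratio z" "ratio z \<le> 1"
  by (auto simp: ratio_def ratio_fun_def min_def max_def divide_le_eq_1 less_le)

lemma ratio_eq_1: "ratio z = 1 \<Longrightarrow> symb z < 2"
  by (auto simp: ratio_def ratio_fun_def symb_def symb_fun_def min_def max_def split: if_splits)

lemma ratio_eq_0:
  assumes "ratio z = 0"
  shows "symb z = 2 \<and> z = pt 0 1 \<or> symb z = 3 \<and> z = pt 1 0"
proof -
  obtain u v where uv: "(u, v) \<noteq> 0" "z = pt u v" by (rule pt_cases)
  then have "u = 0 \<or> v = 0"
    using assms by (auto simp: ratio_pt ratio_fun_def min_def max_def zero_prod_def split: if_splits)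
  then show ?thesis
    using uv pt_scale[of 0 1 v] pt_scale[of 1 0 u]
    by (auto simp: symb_pt symb_fun_def zero_prod_def)
qed

lemma ratio_continuous: "continuous_on UNIV ratio"
  unfolding ratio_def
proof (rule continuous_on_cp1_lift[of "\<lambda>p. ratio_fun (co p)"])
  fix c x y :: complex assume "c \<noteq> 0" "(x, y) \<noteq> 0"
  then show "ratio_fun (co (c * x, c * y)) = ratio_fun (co (x, y))"
    by (simp add: moebius_coord_scale ratio_fun_scale)
next
  have "max (norm (fst (co p))) (norm (snd (co p))) \<noteq> 0" if "p \<in> - {0}" for p
    using co_nonzero[of p] that by (auto simp: max_def prod_eq_iff split: if_splits)
  then show "continuous_on (- {0}) (\<lambda>p. ratio_fun (co p))"
    unfolding ratio_fun_def by (intro continuous_intros) auto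
qed

text \<open>Since \<open>ratio \<circ> f = ratio\<^sup>2 \<le> ratio\<close>, an invariant measure gives full mass to
  \<open>ratio\<^sup>2 = ratio\<close>, that is, to the circle and the two fixed points.\<close>

lemma AE_ratio:
  assumes "invariant_prob f M"
  shows "AE z in M. ratio z = 0 \<or> ratio z = 1"
proof -
  have M: "prob_space M" "sets M = sets borel" "f \<in> measurable M M" "distr M M f = M"
    using assms by (auto simp: invariant_prob_def borel_prob_def)
  interpret prob_space M by fact
  have "ratio \<in> borel_measurable borel"
    using ratio_continuous by (rule borel_measurable_continuous_onI)
  then have meas: "ratio \<in> borel_measurable M"
    using measurable_cong_sets[OF M(2) refl, of borel] by blast
  have int: "integrable M ratio"
    by (rule integrable_const_bound[of _ 1]) (use meas ratio_bounds in auto)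
  have int2: "integrable M (\<lambda>z. (ratio z)\<^sup>2)"
    by (rule integrable_const_bound[of _ 1])
       (use meas ratio_bounds in \<open>auto intro!: power_le_one\<close>)
  have "(\<integral>z. (ratio z)\<^sup>2 \<partial>M) = (\<integral>z. ratio (f z) \<partial>M)" by (simp add: ratio_f)
  also have "\<dots> = (\<integral>z. ratio z \<partial>distr M M f)" by (rule integral_distr[symmetric]) (use M meas in auto)
  finally have "(\<integral>z. ratio z - (ratio z)\<^sup>2 \<partial>M) = 0" using int int2 M(4) by simp
  moreover have nn: "0 \<le> ratio z - (ratio z)\<^sup>2" for z
    using ratio_bounds[of z] by (simp add: power2_eq_square mult_left_le)
  ultimately have "AE z in M. ratio z - (ratio z)\<^sup>2 = 0"
    using integral_nonneg_eq_0_iff_AE[of M "\<lambda>z. ratio z - (ratio z)\<^sup>2"] int int2 by simp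
  then show ?thesis
    by eventually_elim (auto simp: power2_eq_square)
qed

text \<open>Among the points that an invariant measure charges, one symbol singles out each
  attracting fixed point, and on the circle the dyadic arcs shrink.\<close>

lemma itinerary_separates:
  assumes U: "open U" "x \<in> U" and x: "ratio x = 0 \<or> ratio x = 1"
  shows "\<exists>k. \<forall>y\<in>{z. ratio z = 0 \<or> ratio z = 1}.
    itinerary f symb k y = itinerary f symb k x \<longrightarrow> y \<in> U"
  using x
proof
  assume x0: "ratio x = 0"
  have "y \<in> U" if "ratio y = 0 \<or> ratio y = 1" "itinerary f symb 1 y = itinerary f symb 1 x" for y
  proof -
    have "symb y = symb x" using that(2) by (simp add: itinerary_def)
    then show ?thesis
      using that(1) ratio_eq_0[OF x0] ratio_eq_0[of y] ratio_eq_1[of y] U(2) by auto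
  qed
  then show ?thesis by (intro exI[of _ 1]) blast
next
  assume "ratio x = 1"
  then have sx: "symb x < 2" by (rule ratio_eq_1)
  then obtain \<theta> where \<theta>: "0 \<le> \<theta>" "\<theta> < 1" "x = circ \<theta>" by (rule symb_circle)
  have "open (circ -` U)"
    using circ_continuous U(1) by (simp add: continuous_on_open_vimage)
  then obtain d where d: "d > 0" "\<And>t. dist t \<theta> < d \<Longrightarrow> circ t \<in> U"
    using U(2) \<theta>(3) by (auto simp: open_dist)
  obtain k where k: "(1 / 2) ^ k < d" using d(1) real_arch_pow_inv[of d "1/2"] by auto
  \<comment> \<open>The length is positive even for \<open>k = 0\<close>, so the first symbol
    already places \<open>y\<close> on the circle.\<close>
  have "y \<in> U" if "itinerary f symb (Suc k) y = itinerary f symb (Suc k) x" for y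
  proof -
    have "symb y < 2" using that sx by (simp add: itinerary_Suc)
    then obtain t where t: "0 \<le> t" "t < 1" "y = circ t" by (rule symb_circle)
    have "itinerary f symb k y = itinerary f symb k x"
      using that take_itinerary[of k "Suc k" f symb] by (metis le_SucI order_refl)
    moreover have fl: "\<lfloor>t\<rfloor> = 0" "\<lfloor>\<theta>\<rfloor> = 0" using t \<theta> by (simp_all add: floor_eq_iff)
    ultimately have "\<lfloor>2 ^ k * t\<rfloor> = \<lfloor>2 ^ k * \<theta>\<rfloor>"
      unfolding t \<theta> by (subst (asm) itinerary_circ_eq_iff) (simp_all add: fl)
    then have "\<bar>2 ^ k * t - 2 ^ k * \<theta>\<bar> < 1" by linarith
    then have "2 ^ k * \<bar>t - \<theta>\<bar> < 1" by (simp add: abs_mult right_diff_distrib[symmetric])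
    then have "\<bar>t - \<theta>\<bar> < (1 / 2) ^ k" by (simp add: field_simps power_divide)
    then show ?thesis using d(2)[of t] k t by (simp add: dist_real_def)
  qed
  then show ?thesis by blast
qed

text \<open>The upper bound \<open>1 + (1 - ?p) * real (m + 1) * ln 2\<close> for the block entropy
  must reach \<open>real m * ln 2\<close>. This leaves
  \<open>?p * real (m + 1) * ln 2 \<le> 1 + ln 2\<close>, and \<open>1 + ln 2 \<le> 3 * ln 2\<close>
  gives the constant 3.\<close>

lemma cylinder_measure_le:
  assumes inv: "invariant_prob f M" and ent: "ereal (ln 2) \<le> metric_entropy M f" and m: "0 < m"
  shows "measure M {z. itinerary f symb m z = c} \<le> 3 / real (m + 1)"
proof -
  have M: "prob_space M" "sets M = sets borel" "f \<in> measurable M M" "distr M M f = M"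
    using inv by (auto simp: invariant_prob_def borel_prob_def)
  interpret prob_space M by fact
  have sp: "space M = UNIV" using sets_eq_imp_space_eq[OF M(2)] by simp
  note sf = symb_simple_function[OF M(2)]
  let ?I = "itinerary f symb m"
  let ?p = "prob {z. ?I z = c}"
  have sI: "simple_function M ?I" by (rule simple_function_itinerary[OF M(3) sf])
  have "metric_entropy M f \<le> ereal (rv_entropy M ?I / real m)"
  proof (rule metric_entropy_le_rv_entropy[OF M(1,3) sf M(4) _ m])
    fix A assume "A \<in> sets M"
    then show "cylinder_approximable M f symb A"
      using AE_ratio[OF inv]
      by (intro cylinder_approximable_borel[OF M(1,3) sf M(2), of "{z. ratio z = 0 \<or> ratio z = 1}"]
          itinerary_separates) auto
  qed
  then have "ereal (ln 2) \<le> ereal (rv_entropy M ?I / real m)" using ent by (rule order.trans[rotated])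
  then have lower: "real m * ln 2 \<le> rv_entropy M ?I" using m by (simp add: field_simps)
  show ?thesis
  proof (cases "c \<in> range ?I")
    case False
    then have "{z. ?I z = c} = {}" by auto
    then show ?thesis by simp
  next
    case True
    have vi: "?I -` {c} \<inter> space M = {z. ?I z = c}" by (auto simp: sp)
    \<comment> \<open>With the count rounded up to a power of 2 plus 1, the logarithm is exactly
      \<open>real (m + 1) * ln 2\<close>, a single \<open>ln 2\<close> above the lower
      bound.\<close>
    have "card (?I ` space M) \<le> 2 ^ (m + 1) + 1"
    proof -
      have "(2::nat) ^ m + 2 \<le> 2 ^ (m + 1) + 1" using one_le_power[of "2::nat" m] by simp
      then show ?thesis using card_itinerary[of m] unfolding sp by linarith
    qed
    then have "rv_entropy M ?I \<le> 1 + (1 - prob (?I -` {c} \<inter> space M)) * ln (real (2 ^ (m + 1)))"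
      by (intro rv_entropy_le_card[OF sI]) (use True in \<open>simp_all add: sp\<close>)
    then have "rv_entropy M ?I \<le> 1 + (1 - ?p) * ln (real (2 ^ (m + 1)))" unfolding vi .
    also have "ln (real (2 ^ (m + 1))) = real (m + 1) * ln 2"
      unfolding of_nat_power by (subst ln_realpow) auto
    finally have "?p * real (m + 1) * ln 2 \<le> 1 + ln 2"
      using lower by (simp add: algebra_simps)
    also have "\<dots> \<le> 3 * ln 2" using ln2_ge_two_thirds by simp
    finally have "?p * real (m + 1) \<le> 3" by simp
    then show ?thesis by (simp add: field_simps)
  qed
qed

end

section \<open>Lebesgue measure under angle doubling\<close>

lemma emeasure_lborel_affine_vimage:
  fixes c t :: real
  assumes T: "T \<in> sets borel" and c: "c \<noteq> 0"
  shows "emeasure lborel T = ennreal \<bar>c\<bar> * emeasure lborel ((\<lambda>x. t + c * x) -` T)"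
proof -
  have m: "(\<lambda>x. t + c * x) -` T \<in> sets borel"
    using measurable_sets[of "\<lambda>x. t + c * x" borel borel T] T by simp
  have "emeasure lborel T = (\<integral>\<^sup>+x. indicator T x \<partial>lborel)" using T by simp
  also have "\<dots> = ennreal \<bar>c\<bar> * (\<integral>\<^sup>+x. indicator T (t + c * x) \<partial>lborel)"
    by (rule nn_integral_real_affine) (use T c in auto)
  also have "(\<integral>\<^sup>+x. indicator T (t + c * x) \<partial>lborel) =
      (\<integral>\<^sup>+x. indicator ((\<lambda>x. t + c * x) -` T) x \<partial>lborel)"
    by (intro nn_integral_cong) (simp add: indicator_def)
  also have "\<dots> = emeasure lborel ((\<lambda>x. t + c * x) -` T)" using m by simp
  finally show ?thesis .
qed

text \<open>Doubling has the inverse branches \<open>x / 2\<close> and \<open>(x + 1) / 2\<close> on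
  the unit interval. Each carries half of the mass; periodicity of \<open>S\<close> is what handles
  the second.\<close>

lemma emeasure_doubling_vimage:
  fixes S :: "real set"
  assumes S: "S \<in> sets borel" and per: "\<And>x. x - 1 \<in> S \<longleftrightarrow> x \<in> S"
  shows "emeasure lborel ({0..<1} \<inter> {x. 2 * x \<in> S}) = emeasure lborel ({0..<1} \<inter> S)"
proof -
  let ?L = "emeasure lborel ({0..<1} \<inter> S)"
  let ?D = "{x::real. 2 * x \<in> S}"
  have D: "?D \<in> sets borel"
    using measurable_sets[of "\<lambda>x::real. 2 * x" borel borel S] S by (simp add: vimage_def)
  have T: "{0..<1} \<inter> S \<in> sets borel" using S by auto
  have A: "?L = 2 * emeasure lborel ({0..<1/2} \<inter> ?D)"
  proof -
    have "(\<lambda>x::real. 0 + 2 * x) -` ({0..<1} \<inter> S) = {0..<1/2} \<inter> ?D" by auto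
    then show ?thesis using emeasure_lborel_affine_vimage[OF T, of 2 0] by simp
  qed
  have B: "?L = 2 * emeasure lborel ({1/2..<1} \<inter> ?D)"
  proof -
    have "2 * x - 1 \<in> S \<longleftrightarrow> 2 * x \<in> S" for x by (rule per)
    then have "(\<lambda>x::real. - 1 + 2 * x) -` ({0..<1} \<inter> S) = {1/2..<1} \<inter> ?D" by auto
    then show ?thesis using emeasure_lborel_affine_vimage[OF T, of 2 "- 1"] by simp
  qed
  have "{0..<1} \<inter> ?D = ({0..<1/2} \<inter> ?D) \<union> ({1/2..<1} \<inter> ?D)" by auto
  then have "emeasure lborel ({0..<1} \<inter> ?D) =
      emeasure lborel ({0..<1/2} \<inter> ?D) + emeasure lborel ({1/2..<1} \<inter> ?D)"
    using D by (simp only:, subst plus_emeasure) auto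
  also have "emeasure lborel ({1/2..<1} \<inter> ?D) = emeasure lborel ({0..<1/2} \<inter> ?D)"
  proof -
    have "2 * emeasure lborel ({1/2..<1} \<inter> ?D) = 2 * emeasure lborel ({0..<1/2} \<inter> ?D)"
      by (rule trans[OF B[symmetric] A])
    then show ?thesis by (simp only: ennreal_mult_cancel_left) simp
  qed
  also have "emeasure lborel ({0..<1/2} \<inter> ?D) + emeasure lborel ({0..<1/2} \<inter> ?D) = ?L"
    using A by (simp only: mult_2)
  finally show ?thesis .
qed

text \<open>Entropy is the mean of \<open>- ln (?q v)\<close>, which is at least \<open>h\<close> on
  every cell that carries mass.\<close>

lemma (in prob_space) rv_entropy_ge:
  assumes X: "simple_function M X" and h: "\<And>v. prob (X -` {v} \<inter> space M) \<le> exp (- h)"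
  shows "h \<le> rv_entropy M X"
proof -
  let ?q = "\<lambda>v. prob (X -` {v} \<inter> space M)"
  have fin: "finite (X ` space M)" using X by (simp add: simple_function_def)
  have "(\<Sum>v\<in>X ` space M. ?q v) = prob (\<Union>v\<in>X ` space M. X -` {v} \<inter> space M)"
    by (rule finite_measure_finite_Union[symmetric])
       (use X fin in \<open>auto simp: disjoint_family_on_def simple_function_def\<close>)
  also have "(\<Union>v\<in>X ` space M. X -` {v} \<inter> space M) = space M" by auto
  finally have "h = (\<Sum>v\<in>X ` space M. ?q v * h)"
    by (simp add: prob_space flip: sum_distrib_right)
  also have "\<dots> \<le> (\<Sum>v\<in>X ` space M. - (?q v * ln (?q v)))"
  proof (rule sum_mono)
    fix v
    show "?q v * h \<le> - (?q v * ln (?q v))"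
    proof (cases "?q v = 0")
      case False
      then have "0 < ?q v" by (simp add: less_le)
      then have "ln (?q v) \<le> - h" using h[of v] by (metis exp_ln ln_exp exp_gt_zero ln_le_cancel_iff)
      then have "?q v * h \<le> ?q v * (- ln (?q v))" by (intro mult_left_mono) auto
      then show ?thesis by simp
    qed simp
  qed
  finally show ?thesis by (simp add: rv_entropy_def sum_negf)
qed

section \<open>Chords of the circle, and a test function for infinity\<close>

lemma floor_diff_cases:
  fixes x y :: real
  assumes "\<bar>x - y - of_int k\<bar> < 1"
  shows "\<lfloor>x\<rfloor> - \<lfloor>y\<rfloor> - k \<in> {- 1, 0, 1}"
proof -
  have "real_of_int (\<lfloor>x\<rfloor> - \<lfloor>y\<rfloor> - k) < of_int 2" "of_int (- 2) < real_of_int (\<lfloor>x\<rfloor> - \<lfloor>y\<rfloor> - k)"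
    using assms floor_correct[of x] floor_correct[of y] unfolding of_int_diff abs_less_iff by linarith+
  then have "\<lfloor>x\<rfloor> - \<lfloor>y\<rfloor> - k < 2" "- 2 < \<lfloor>x\<rfloor> - \<lfloor>y\<rfloor> - k" unfolding of_int_less_iff .
  then show ?thesis by auto
qed

text \<open>Compactness replaces an explicit estimate of the sine. The resulting
  \<open>\<delta>\<close> depends on \<open>\<eta>\<close> alone, so it can be fixed before the
  roots move.\<close>

lemma chord_small:
  assumes "0 < (\<eta>::real)"
  obtains \<delta> where "0 < \<delta>"
    "\<And>x y. \<bar>x - y\<bar> \<le> 1 \<Longrightarrow> norm (cis (2 * pi * x) - cis (2 * pi * y)) < \<delta> \<Longrightarrow>
      \<exists>k\<in>{- 1, 0, 1}. \<bar>x - y - of_int k\<bar> < \<eta>"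
proof -
  define g where "g u = norm (cis (2 * pi * u) - 1)" for u :: real
  \<comment> \<open>Differences at distance at least \<open>\<eta>\<close> from the integers in
    \<open>[-1, 1]\<close>; there the chord has a positive minimum.\<close>
  define K where "K = {- 1..1} \<inter> (\<Inter>k\<in>{- 1, 0, 1::int}. {u::real. \<eta> \<le> \<bar>u - of_int k\<bar>})"
  have "compact K"
    unfolding K_def
    by (intro compact_Int_closed closed_INT ballI closed_Collect_le continuous_intros) simp
  moreover have "continuous_on K g" unfolding g_def by (intro continuous_intros)
  moreover have pos: "0 < g u" if u: "u \<in> K" for u
  proof -
    have "cis (2 * pi * u) \<noteq> 1"
    proof
      assume "cis (2 * pi * u) = 1"
      then have "cos (2 * pi * u) = 1" by (simp add: complex_eq_iff)
      then obtain n :: int where "2 * pi * u = of_int n * 2 * pi"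
        using cos_one_2pi_int by blast
      then have un: "u = of_int n" by simp
      with u have "- 1 \<le> n" "n \<le> 1" by (auto simp: K_def)
      then have "n \<in> {- 1, 0, 1}" by auto
      with u un assms show False unfolding K_def by fastforce
    qed
    then show ?thesis by (simp add: g_def)
  qed
  ultimately obtain \<delta> where \<delta>: "0 < \<delta>" "\<And>u. u \<in> K \<Longrightarrow> \<delta> \<le> g u"
  proof (cases "K = {}")
    case True
    then show ?thesis using that[of 1] by simp
  next
    case False
    obtain u0 where "u0 \<in> K" "\<forall>u\<in>K. g u0 \<le> g u"
      using continuous_attains_inf[OF \<open>compact K\<close> False \<open>continuous_on K g\<close>] by blast
    then show ?thesis using that[of "g u0"] pos by blast
  qed
  show thesis
  proof (rule that[OF \<delta>(1)], rule ccontr)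
    fix x y :: real
    assume xy: "\<bar>x - y\<bar> \<le> 1" "norm (cis (2 * pi * x) - cis (2 * pi * y)) < \<delta>"
      and far: "\<not> (\<exists>k\<in>{- 1, 0, 1}. \<bar>x - y - of_int k\<bar> < \<eta>)"
    have "x - y \<in> {- 1..1}" using xy(1) by (simp add: abs_le_iff)
    moreover have "\<eta> \<le> \<bar>x - y - of_int k\<bar>" if "k \<in> {- 1, 0, 1}" for k
      using far that by (meson not_less)
    ultimately have "x - y \<in> K" unfolding K_def by blast
    have "cis (2 * pi * x) - cis (2 * pi * y) = cis (2 * pi * y) * (cis (2 * pi * (x - y)) - 1)"
      by (simp add: right_diff_distrib cis_mult)
    then have "norm (cis (2 * pi * x) - cis (2 * pi * y)) = g (x - y)"
      by (simp add: norm_mult g_def)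
    then show False using \<delta>(2)[OF \<open>x - y \<in> K\<close>] xy by simp
  qed
qed

text \<open>In the affine coordinate this is 1/(1+|z|), extended by 0 at infinity.\<close>

definition depth_fun :: "complex \<times> complex \<Rightarrow> real" where
  "depth_fun p = norm (snd p) / (norm (fst p) + norm (snd p))"

definition depth :: "cp1 \<Rightarrow> real" where
  "depth z = depth_fun (rep_cp1 z)"

lemma depth_fun_scale: "c \<noteq> 0 \<Longrightarrow> depth_fun (c * x, c * y) = depth_fun (x, y)"
  by (simp add: depth_fun_def norm_mult flip: distrib_left)

lemma depth_pt: "(x, y) \<noteq> 0 \<Longrightarrow> depth (cp1_pt x y) = norm y / (norm x + norm y)"
  using rep_cp1_lift[of depth_fun x y] by (simp add: depth_def depth_fun_scale) (simp add: depth_fun_def)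

lemma depth_continuous: "continuous_on UNIV depth"
  unfolding depth_def
proof (rule continuous_on_cp1_lift)
  have "norm (fst p) + norm (snd p) \<noteq> 0" if "p \<in> - {0}" for p :: "complex \<times> complex"
    using that by (auto simp: add_nonneg_eq_0_iff prod_eq_iff)
  then show "continuous_on (- {0}) depth_fun"
    unfolding depth_fun_def by (intro continuous_intros) auto
qed (simp add: depth_fun_scale)

lemma depth_bounds: "0 \<le> depth z" "depth z \<le> 1"
  by (auto simp: depth_def depth_fun_def divide_le_eq_1 not_less intro!: antisym)

lemma depth_eq_0_iff: "depth z = 0 \<longleftrightarrow> z = cp1_infinity"
proof -
  obtain x y where xy: "(x, y) \<noteq> 0" "z = cp1_pt x y" by (rule cp1_cases)
  show ?thesis
    unfolding xy(2) depth_pt[OF xy(1)] cp1_pt_eq_infinity_iff[OF xy(1)]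
    using xy(1) by (auto simp: zero_prod_def add_nonneg_eq_0_iff)
qed

section \<open>Entropy of the circle measure, and mass away from infinity\<close>

context quadratic_newton
begin

lemma circ_measurable: "circ \<in> borel_measurable borel"
  using circ_continuous by (rule borel_measurable_continuous_onI)

text \<open>Haar measure of the circle |w| = 1. It enters as a competitor: a maximal measure has at
  least its entropy.\<close>

definition circ_measure :: "cp1 measure" where
  "circ_measure = distr (uniform_measure lborel {0..<1}) borel circ"

lemma emeasure_circ_measure:
  assumes "B \<in> sets borel"
  shows "emeasure circ_measure B = emeasure lborel ({0..<1} \<inter> circ -` B)"
proof -
  have "circ -` B \<in> sets borel" using measurable_sets[OF circ_measurable assms] by simp
  then show ?thesis
    using assms circ_measurable
    by (simp add: circ_measure_def emeasure_distr emeasure_uniform_measure divide_ennreal_def)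
qed

lemma invariant_circ_measure: "invariant_prob f circ_measure"
proof -
  have "prob_space (uniform_measure lborel {0..<1::real})"
    by (rule prob_space_uniform_measure) auto
  then have p: "prob_space circ_measure"
    unfolding circ_measure_def by (rule prob_space.prob_space_distr)
      (use circ_measurable in \<open>simp add: measurable_cong_sets[OF sets_uniform_measure refl]\<close>)
  have s: "sets circ_measure = sets borel" by (simp add: circ_measure_def)
  have fb: "f \<in> borel_measurable borel"
    using f_continuous by (rule borel_measurable_continuous_onI)
  then have fm: "f \<in> measurable circ_measure circ_measure"
    using measurable_cong_sets[OF s s] by blast
  have "distr circ_measure circ_measure f = circ_measure"
  proof (rule measure_eqI)
    fix B assume "B \<in> sets (distr circ_measure circ_measure f)"
    then have B: "B \<in> sets borel" using s by simp
    then have fB: "f -` B \<in> sets borel" using measurable_sets[OF fb] by simp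
    have cB: "circ -` B \<in> sets borel" using measurable_sets[OF circ_measurable B] by simp
    have "emeasure (distr circ_measure circ_measure f) B = emeasure circ_measure (f -` B)"
      using B s fm sets_eq_imp_space_eq[OF s] by (simp add: emeasure_distr)
    also have "\<dots> = emeasure lborel ({0..<1} \<inter> circ -` f -` B)" by (rule emeasure_circ_measure[OF fB])
    also have "circ -` f -` B = {x. 2 * x \<in> circ -` B}" by (auto simp: f_circ)
    also have "emeasure lborel ({0..<1} \<inter> {x. 2 * x \<in> circ -` B}) = emeasure lborel ({0..<1} \<inter> circ -` B)"
    proof (rule emeasure_doubling_vimage[OF cB])
      fix x :: real
      have "frac (x - 1) = frac x" using frac_1_eq[of "x - 1"] by simp
      then show "x - 1 \<in> circ -` B \<longleftrightarrow> x \<in> circ -` B"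
        using circ_frac[of x] circ_frac[of "x - 1"] by simp
    qed
    also have "\<dots> = emeasure circ_measure B" by (rule emeasure_circ_measure[OF B, symmetric])
    finally show "emeasure (distr circ_measure circ_measure f) B = emeasure circ_measure B" .
  qed simp
  with p s fm show ?thesis by (simp add: invariant_prob_def borel_prob_def)
qed

text \<open>A cylinder of length \<open>n\<close> meets the circle in at most a dyadic arc of length
  \<open>1 / 2 ^ n\<close>, so words of length \<open>n\<close> have entropy at least
  \<open>real n * ln 2\<close>. The coding partition is one candidate in the supremum.\<close>

lemma entropy_circ_measure: "ereal (ln 2) \<le> metric_entropy circ_measure f"
proof -
  have M: "prob_space circ_measure" "sets circ_measure = sets borel"
      "f \<in> measurable circ_measure circ_measure"
    using invariant_circ_measure by (auto simp: invariant_prob_def borel_prob_def)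
  interpret prob_space circ_measure by fact
  have sp: "space circ_measure = UNIV" using sets_eq_imp_space_eq[OF M(2)] by simp
  note sf = symb_simple_function[OF M(2)]
  have "real n * ln 2 \<le> rv_entropy circ_measure (itinerary f symb n)" for n
  proof (rule rv_entropy_ge)
    show sI: "simple_function circ_measure (itinerary f symb n)"
      by (rule simple_function_itinerary[OF M(3) sf])
    fix c
    let ?B = "itinerary f symb n -` {c} \<inter> space circ_measure"
    have B: "?B \<in> sets borel" using simple_functionD(2)[OF sI] M(2) by simp
    have "emeasure circ_measure ?B \<le> ennreal (1 / 2 ^ n)"
    proof (cases "{0..<1} \<inter> circ -` ?B = {}")
      case True
      then show ?thesis using emeasure_circ_measure[OF B] by (simp only: emeasure_empty) simp
    next
      case False
      then obtain x where "x \<in> {0..<1} \<inter> circ -` ?B" by blast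
      then have x: "0 \<le> x" "x < 1" "itinerary f symb n (circ x) = c" by auto
      let ?k = "\<lfloor>2 ^ n * x\<rfloor>"
      have "{0..<1} \<inter> circ -` ?B \<subseteq> {of_int ?k / 2 ^ n..<(of_int ?k + 1) / 2 ^ n}"
      proof
        fix y assume "y \<in> {0..<1} \<inter> circ -` ?B"
        then have y: "0 \<le> y" "y < 1" "itinerary f symb n (circ y) = itinerary f symb n (circ x)"
          using x by auto
        have "\<lfloor>y\<rfloor> = 0" "\<lfloor>x\<rfloor> = 0" using x y by (simp_all add: floor_eq_iff)
        then have "\<lfloor>2 ^ n * y\<rfloor> = ?k" using y(3) itinerary_circ_eq_iff[of y x n] by simp
        then have "of_int ?k \<le> 2 ^ n * y" "2 ^ n * y < of_int ?k + 1" by linarith+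
        then show "y \<in> {of_int ?k / 2 ^ n..<(of_int ?k + 1) / 2 ^ n}"
          by (simp add: field_simps)
      qed
      then have "emeasure lborel ({0..<1} \<inter> circ -` ?B) \<le>
          emeasure lborel {real_of_int ?k / 2 ^ n..<(of_int ?k + 1) / 2 ^ n}"
        by (rule emeasure_mono) simp
      also have "\<dots> = ennreal ((of_int ?k + 1) / 2 ^ n - of_int ?k / 2 ^ n)"
        by (rule emeasure_lborel_Ico) (simp add: divide_right_mono)
      also have "(of_int ?k + 1) / 2 ^ n - of_int ?k / 2 ^ n = 1 / (2::real) ^ n"
        by (simp add: diff_divide_distrib[symmetric])
      finally show ?thesis using emeasure_circ_measure[OF B] by simp
    qed
    then have "prob ?B \<le> 1 / 2 ^ n" by (simp add: emeasure_eq_measure)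
    also have "1 / (2::real) ^ n = exp (- (real n * ln 2))"
      by (simp add: exp_minus exp_of_nat_mult inverse_eq_divide)
    finally show "prob ?B \<le> exp (- (real n * ln 2))" .
  qed
  then have le: "ln 2 \<le> partition_entropy circ_measure
      (dyn_refinement circ_measure f (fibres circ_measure symb) n) / real n" if "0 < n" for n
    unfolding partition_entropy_dyn_refinement[OF M(3) sf] using that by (simp add: field_simps)
  show ?thesis
    unfolding metric_entropy_def
  proof (rule SUP_upper2[OF fibres_in_finite_partitions[OF sf]], rule le_Limsup)
    show "\<forall>\<^sub>F n in sequentially. ereal (ln 2) \<le> ereal (partition_entropy circ_measure
      (dyn_refinement circ_measure f (fibres circ_measure symb) n) / real n)"
      using eventually_gt_at_top[of 0] by eventually_elim (use le in simp)
  qed simp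
qed

lemma maximal_measure_cylinder_le:
  assumes "maximal_measure f M" "0 < m"
  shows "measure M {z. itinerary f symb m z = c} \<le> 3 / real (m + 1)"
  using assms invariant_circ_measure entropy_circ_measure
  by (intro cylinder_measure_le) (auto simp: maximal_measure_def intro: order.trans)

text \<open>On the circle \<open>|w| = 1\<close>, the points \<open>z = (a - b w) / (1 - w)\<close> with \<open>|z| \<le> 1 / \<epsilon>\<close> lie in a
  short arc around \<open>a / b\<close>, which meets at most nine cylinders of length \<open>m\<close>.\<close>

lemma maximal_measure_depth_le:
  assumes max: "maximal_measure f M" and m: "0 < m" and \<epsilon>: "0 < \<epsilon>"
    and chord: "\<And>x y. \<bar>x - y\<bar> \<le> 1 \<Longrightarrow> norm (cis (2 * pi * x) - cis (2 * pi * y)) < \<delta> \<Longrightarrow>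
      \<exists>k\<in>{- 1, 0, 1}. \<bar>x - y - of_int k\<bar> < 1 / 2 ^ m"
    and b: "4 / \<epsilon> < \<delta> * norm b"
  shows "measure M {z. \<epsilon> < depth z} \<le> 33 / real (m + 1)"
proof -
  have inv: "invariant_prob f M" using max by (simp add: maximal_measure_def)
  have M: "prob_space M" "sets M = sets borel" "f \<in> measurable M M"
    using inv by (auto simp: invariant_prob_def borel_prob_def)
  interpret prob_space M by fact
  have sp: "space M = UNIV" using sets_eq_imp_space_eq[OF M(2)] by simp
  let ?I = "itinerary f symb m"
  have meas: "{z. ?I z \<in> C} \<in> sets M" for C
    using simple_functionD(2)[OF simple_function_itinerary[OF M(3) symb_simple_function[OF M(2)]], of m C]
    by (simp add: sp vimage_def)
  have b0: "b \<noteq> 0" using b \<epsilon> by (auto simp: not_less)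
  define A where "A = {x. 0 \<le> x \<and> x < 1 \<and> \<epsilon> < depth (circ x)}"
  \<comment> \<open>Depth above \<open>\<epsilon>\<close> gives
    \<open>\<epsilon> * norm (a - b * ?w) < norm (1 - ?w) \<le> 2\<close>; dividing by
    \<open>b\<close> places \<open>?w\<close> near \<open>a / b\<close>.\<close>
  have arc: "norm (cis (2 * pi * x) - a / b) < 2 / (\<epsilon> * norm b)" if "x \<in> A" for x
  proof -
    let ?w = "cis (2 * pi * x)"
    have "(a * 1 - b * ?w, 1 - ?w) \<noteq> 0" by (rule pt_nonzero) (simp add: zero_prod_def)
    then have nz: "(a - b * ?w, 1 - ?w) \<noteq> 0" by simp
    have "\<epsilon> < depth (cp1_pt (a - b * ?w) (1 - ?w))"
      using that by (simp add: A_def circ_def moebius_pt_def)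
    then have "\<epsilon> < norm (1 - ?w) / (norm (a - b * ?w) + norm (1 - ?w))" by (simp add: depth_pt[OF nz])
    moreover have "0 < norm (a - b * ?w) + norm (1 - ?w)"
      using nz by (auto simp: zero_prod_def add_nonneg_pos add_pos_nonneg)
    ultimately have "\<epsilon> * (norm (a - b * ?w) + norm (1 - ?w)) < norm (1 - ?w)"
      by (simp add: pos_less_divide_eq)
    moreover have "norm (1 - ?w) \<le> 2" using norm_triangle_ineq4[of 1 ?w] by simp
    moreover have "0 \<le> \<epsilon> * norm (1 - ?w)" using \<epsilon> by simp
    ultimately have "\<epsilon> * norm (a - b * ?w) < 2" by (simp add: distrib_left)
    moreover have "norm (a - b * ?w) = norm b * norm (?w - a / b)"
    proof -
      have "a - b * ?w = - b * (?w - a / b)" using b0 by (simp add: right_diff_distrib)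
      then show ?thesis by (simp only: norm_mult norm_minus_cancel)
    qed
    ultimately show ?thesis using \<epsilon> b0 by (simp add: field_simps)
  qed
  have close: "\<exists>k\<in>{- 1, 0, 1}. \<bar>x - y - of_int k\<bar> < 1 / 2 ^ m" if "x \<in> A" "y \<in> A" for x y
  proof (rule chord)
    show "\<bar>x - y\<bar> \<le> 1" using that by (auto simp: A_def)
    have "norm (cis (2 * pi * x) - cis (2 * pi * y)) \<le>
        norm (cis (2 * pi * x) - a / b) + norm (cis (2 * pi * y) - a / b)"
      using norm_triangle_ineq4[of "cis (2 * pi * x) - a / b" "cis (2 * pi * y) - a / b"] by simp
    also have "\<dots> < 4 / (\<epsilon> * norm b)" using arc[OF that(1)] arc[OF that(2)] by simp
    also have "\<dots> < \<delta>" using b \<epsilon> b0 by (simp add: field_simps)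
    finally show "norm (cis (2 * pi * x) - cis (2 * pi * y)) < \<delta>" .
  qed
  define F where "F = (\<lambda>x. \<lfloor>2 ^ m * x\<rfloor>) ` A"
  have F: "finite F \<and> card F \<le> 9"
  proof (cases "A = {}")
    case False
    then obtain y where y: "y \<in> A" by blast
    \<comment> \<open>Three times three candidates: \<open>k\<close> accounts for angles that wrap
      around a full turn, \<open>j\<close> for the rounding by the two floors.\<close>
    let ?T = "(\<lambda>(k, j). \<lfloor>2 ^ m * y\<rfloor> + 2 ^ m * k + j) ` ({- 1, 0, 1} \<times> {- 1, 0, 1::int})"
    have "F \<subseteq> ?T"
    proof
      fix n assume "n \<in> F"
      then obtain x where x: "x \<in> A" "n = \<lfloor>2 ^ m * x\<rfloor>" by (auto simp: F_def)
      obtain k :: int where k: "k \<in> {- 1, 0, 1}" "\<bar>x - y - of_int k\<bar> < 1 / 2 ^ m"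
        using close[OF x(1) y] by blast
      have "\<bar>2 ^ m * x - 2 ^ m * y - 2 ^ m * of_int k\<bar> = 2 ^ m * \<bar>x - y - of_int k\<bar>"
        by (simp add: abs_mult flip: right_diff_distrib)
      also have "\<dots> < 1" using k(2) by (simp add: field_simps)
      finally have "\<bar>2 ^ m * x - 2 ^ m * y - of_int (2 ^ m * k)\<bar> < 1" by simp
      then have "n - \<lfloor>2 ^ m * y\<rfloor> - 2 ^ m * k \<in> {- 1, 0, 1}"
        unfolding x(2) by (rule floor_diff_cases)
      then show "n \<in> ?T"
        using k(1) by (intro image_eqI[of _ _ "(k, n - \<lfloor>2 ^ m * y\<rfloor> - 2 ^ m * k)"]) auto
    qed
    moreover have "card ?T \<le> 9"
      using card_image_le[of "{- 1, 0, 1} \<times> {- 1, 0, 1::int}" "\<lambda>(k, j). \<lfloor>2 ^ m * y\<rfloor> + 2 ^ m * k + j"]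
      by (simp add: card_cartesian_product)
    ultimately show ?thesis
      using card_mono[of ?T F] finite_subset[of F ?T] by fastforce
  qed (simp add: F_def)
  \<comment> \<open>On \<open>A\<close> the word depends only on the floor, so one representative
    per element of \<open>F\<close> yields all words.\<close>
  define code where "code n = ?I (circ (SOME x. x \<in> A \<and> \<lfloor>2 ^ m * x\<rfloor> = n))" for n
  have code: "?I (circ x) = code \<lfloor>2 ^ m * x\<rfloor>" if x: "x \<in> A" for x
  proof -
    define x' where "x' = (SOME y. y \<in> A \<and> \<lfloor>2 ^ m * y\<rfloor> = \<lfloor>2 ^ m * x\<rfloor>)"
    have x': "x' \<in> A \<and> \<lfloor>2 ^ m * x'\<rfloor> = \<lfloor>2 ^ m * x\<rfloor>"
      unfolding x'_def by (rule someI[of _ x]) (use x in simp)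
    have "\<lfloor>x\<rfloor> = 0" "\<lfloor>x'\<rfloor> = 0" using x x' by (simp_all add: A_def floor_eq_iff)
    then show ?thesis
      using itinerary_circ_eq_iff[of x x' m] x' by (simp add: code_def x'_def)
  qed
  \<comment> \<open>The basins may also contain points of large depth. Each is a single cylinder,
    which raises the count from 9 words to 11.\<close>
  let ?C = "code ` F \<union> {replicate m 2, replicate m 3}"
  have "{z. \<epsilon> < depth z} \<subseteq> (\<Union>c\<in>?C. {z. ?I z = c})"
  proof
    fix z assume z: "z \<in> {z. \<epsilon> < depth z}"
    consider "symb z < 2" | "symb z = 2" | "symb z = 3" using symb_less[of z] by linarith
    then have "?I z \<in> ?C"
    proof cases
      case 1
      then obtain x where "0 \<le> x" "x < 1" "z = circ x" by (rule symb_circle)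
      then show ?thesis using z code[of x] by (auto simp: A_def F_def)
    qed (auto simp: list_eq_iff_nth_eq nth_itinerary symb_funpow_f)
    then show "z \<in> (\<Union>c\<in>?C. {z. ?I z = c})" by blast
  qed
  then have "measure M {z. \<epsilon> < depth z} \<le> measure M (\<Union>c\<in>?C. {z. ?I z = c})"
  proof (rule finite_measure_mono)
    have "(\<Union>c\<in>?C. {z. ?I z = c}) = {z. ?I z \<in> ?C}" by blast
    then show "(\<Union>c\<in>?C. {z. ?I z = c}) \<in> sets M" using meas by (simp only:)
  qed
  also have "\<dots> \<le> (\<Sum>c\<in>?C. measure M {z. ?I z = c})"
    by (rule finite_measure_subadditive_finite) (use F meas[of "{_}"] in auto)
  also have "\<dots> \<le> (\<Sum>c\<in>?C. 3 / real (m + 1))"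
    by (intro sum_mono maximal_measure_cylinder_le[OF max m])
  also have "\<dots> = real (card ?C) * (3 / real (m + 1))" by simp
  also have "\<dots> \<le> 11 * (3 / real (m + 1))"
  proof (rule mult_right_mono)
    have "card ?C \<le> card (code ` F) + card {replicate m (2::nat), replicate m 3}" by (rule card_Un_le)
    also have "card (code ` F) \<le> 9" using card_image_le[of F code] F by linarith
    also have "card {replicate m (2::nat), replicate m 3} \<le> 2" by (simp add: card_insert_if)
    finally show "real (card ?C) \<le> 11" by simp
  qed simp
  finally show ?thesis by simp
qed

end

section \<open>Degenerating Newton maps\<close>

lemma self_in_proj_class: "F \<in> proj_class F"
  by (auto simp: proj_class_def intro!: exI[of _ 1])

lemma proj_class_eqD:
  assumes "proj_class F = proj_class G"
  obtains c where "c \<noteq> 0" "F = (smult c (fst G), smult c (snd G))"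
  using self_in_proj_class[of F] assms by (auto simp: proj_class_def)

abbreviation form_coeffs :: "form_pair \<Rightarrow> (nat \<Rightarrow> complex) \<times> (nat \<Rightarrow> complex)" where
  "form_coeffs F \<equiv> (coeff (fst F), coeff (snd F))"

text \<open>An open condition on coefficients that is invariant under scaling defines an open subset
  of the projective space, so convergence eventually imposes it on every representative of
  \<open>N t\<close>.\<close>

lemma eventually_form_coeffs:
  assumes lim: "limitin (proj_topology d) N (proj_class F) L" and F: "F \<in> form_pairs d"
    and "open C" and FC: "form_coeffs F \<in> C"
    and scale: "\<And>c p q. c \<noteq> 0 \<Longrightarrow> (p, q) \<in> C \<Longrightarrow> (\<lambda>i. c * p i, \<lambda>i. c * q i) \<in> C"
  shows "\<forall>\<^sub>F t in L. \<forall>G. N t = proj_class G \<longrightarrow> form_coeffs G \<in> C"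
proof -
  define U where "U = proj_class ` {G \<in> form_pairs d. form_coeffs G \<in> C}"
  have inv: "form_coeffs G \<in> C" if G: "proj_class G \<in> U" for G
  proof -
    obtain H where H: "proj_class G = proj_class H" "H \<in> {G \<in> form_pairs d. form_coeffs G \<in> C}"
      using G unfolding U_def by (rule imageE)
    obtain c where "c \<noteq> 0" "G = (smult c (fst H), smult c (snd H))" using proj_class_eqD[OF H(1)] .
    then show ?thesis using scale[of c "coeff (fst H)" "coeff (snd H)"] H(2) by (simp add: fun_eq_iff coeff_smult[abs_def])
  qed
  have mem: "proj_class G \<in> U" if "G \<in> form_pairs d" "form_coeffs G \<in> C" for G
    unfolding U_def using that by (intro imageI) simp
  have "{G \<in> form_pairs d. proj_class G \<in> U} = form_coeffs -` C \<inter> form_pairs d"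
    using inv mem by (intro set_eqI) (simp only: mem_Collect_eq vimage_eq Int_iff, blast)
  moreover have "openin (form_pairs_topology d) (form_coeffs -` C \<inter> form_pairs d)"
    unfolding form_pairs_topology_def openin_pullback_topology
    using \<open>open C\<close> by (intro exI[of _ C] conjI) (simp_all only: open_openin)
  ultimately have "openin (proj_topology d) U"
    by (simp only: openin_proj_topology) (auto simp: U_def proj_space_def)
  moreover have "proj_class F \<in> U" using F FC by (rule mem)
  ultimately have "\<forall>\<^sub>F t in L. N t \<in> U" using lim by (simp add: limitin_def)
  then show ?thesis by eventually_elim (use inv in auto)
qed

lemma continuous_on_form_coeffs [continuous_intros]:
  "continuous_on UNIV (\<lambda>c :: (nat \<Rightarrow> complex) \<times> (nat \<Rightarrow> complex). fst c i)"
  "continuous_on UNIV (\<lambda>c :: (nat \<Rightarrow> complex) \<times> (nat \<Rightarrow> complex). snd c i)"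
  by (rule continuous_on_compose2[OF continuous_on_product_coordinates], intro continuous_intros, simp)+

section \<open>Coefficients of quadratic Newton maps and their limits\<close>

definition quadratic_newton_pair :: "complex \<Rightarrow> complex \<Rightarrow> form_pair" where
  "quadratic_newton_pair a b = ([:- (a * b), 0, 1:], [:- (a + b), 2:])"

lemma newton_maps_2E:
  assumes "g \<in> newton_maps 2"
  obtains a b where "a \<noteq> b" "g = proj_class (quadratic_newton_pair a b)"
proof -
  obtain P where P: "g = proj_class (newton_pair P)" "lead_coeff P = 1" "degree P = 2"
      "card {z. poly P z = 0} = 2"
    using assms by (auto simp: newton_maps_def)
  then obtain a b where ab: "{z. poly P z = 0} = {a, b}" "a \<noteq> b"
    by (metis card_2_iff)
  have "[:- a, 1:] dvd P" using ab by (metis (mono_tags) insertI1 mem_Collect_eq poly_eq_0_iff_dvd)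
  then obtain Q where Q: "P = [:- a, 1:] * Q" by (elim dvdE)
  have "poly P b = 0" using ab by blast
  then have "poly Q b = 0" using ab(2) by (simp add: Q)
  then obtain R where R: "Q = [:- b, 1:] * R" by (auto simp: poly_eq_0_iff_dvd elim!: dvdE)
  have P0: "R \<noteq> 0" using P(3) Q R by auto
  have "degree P = 2 + degree R"
    unfolding Q R using P0
    by (simp add: degree_mult_eq del: mult_pCons_left mult_pCons_right)
  then obtain r where r: "R = [:r:]" using P(3) by (metis add_cancel_right_right degree_eq_zeroE)
  have "r = 1" using P(2) unfolding Q R r by (simp add: lead_coeff_mult del: mult_pCons_left mult_pCons_right)
  then have "newton_pair P = quadratic_newton_pair a b"
    unfolding Q R r newton_pair_def quadratic_newton_pair_def
    by (simp add: pderiv_pCons pderiv_mult algebra_simps)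
  then show thesis using that ab(2) P(1) by simp
qed

lemma quadratic_newton_pair_in_form_pairs: "quadratic_newton_pair a b \<in> form_pairs 2"
  by (simp add: quadratic_newton_pair_def form_pairs_def)

text \<open>After substituting \<open>x = a * v - b * u\<close> and \<open>y = v - u\<close>, both
  forms contain the factor \<open>a - b\<close>; once it is removed, the Moebius parametrisation of
  the squares remains.\<close>

lemma quadratic_newton_rat_map:
  assumes "a \<noteq> b"
  shows "quadratic_newton a b (rat_map (proj_class (quadratic_newton_pair a b)))"
proof
  fix u v :: complex assume uv: "(u, v) \<noteq> 0"
  let ?F = "quadratic_newton_pair a b"
  have "coprime (fst ?F) (snd ?F)"
  proof (rule coprimeI)
    fix q assume q: "q dvd fst ?F" "q dvd snd ?F"
    \<comment> \<open>A Bezout identity with nonzero constant right-hand side: nothing cancels, and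
      \<open>rat_map\<close> evaluates the pair itself.\<close>
    have "smult 4 (fst ?F) - [:a + b, 2:] * snd ?F = [:(a - b)\<^sup>2:]"
      by (simp add: quadratic_newton_pair_def power2_eq_square algebra_simps)
    moreover have "q dvd smult 4 (fst ?F) - [:a + b, 2:] * snd ?F"
      using q by (intro dvd_diff dvd_smult dvd_mult)
    ultimately have "q dvd [:(a - b)\<^sup>2:]" by simp
    moreover have "is_unit [:(a - b)\<^sup>2:]" using assms by (simp add: is_unit_pCons_iff)
    ultimately show "is_unit q" by (rule dvd_trans)
  qed
  then have h: "hat_pair ?F = ?F" by (simp add: hat_pair_def gcd_part_def)
  have d: "hat_degree ?F = 2" unfolding hat_degree_def h by (simp add: quadratic_newton_pair_def)
  have nz: "(a * v - b * u, v - u) \<noteq> 0"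
    using uv assms by (auto simp: zero_prod_def left_diff_distrib[symmetric])
  define x y where "x = a * v - b * u" and "y = v - u"
  have e: "form_eval 2 (fst ?F) x y = x\<^sup>2 - a * b * y\<^sup>2" "form_eval 2 (snd ?F) x y = 2 * x * y - (a + b) * y\<^sup>2"
    by (simp_all add: form_eval_def quadratic_newton_pair_def numeral_2_eq_2 algebra_simps)
  have "rat_map (proj_class ?F) (moebius_pt a b u v) =
      cp1_pt (x\<^sup>2 - a * b * y\<^sup>2) (2 * x * y - (a + b) * y\<^sup>2)"
    using rat_map_proj_class[OF quadratic_newton_pair_in_form_pairs[of a b] nz]
    unfolding moebius_pt_def x_def[symmetric] y_def[symmetric] d h e .
  also have "x\<^sup>2 - a * b * y\<^sup>2 = (a - b) * (a * v\<^sup>2 - b * u\<^sup>2)"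
    by (simp add: x_def y_def power2_eq_square algebra_simps)
  also have "2 * x * y - (a + b) * y\<^sup>2 = (a - b) * (v\<^sup>2 - u\<^sup>2)"
    by (simp add: x_def y_def power2_eq_square algebra_simps)
  also have "cp1_pt ((a - b) * (a * v\<^sup>2 - b * u\<^sup>2)) ((a - b) * (v\<^sup>2 - u\<^sup>2)) = moebius_pt a b (u\<^sup>2) (v\<^sup>2)"
    unfolding moebius_pt_def
  proof (rule cp1_pt_scale)
    have "u\<^sup>2 \<noteq> 0 \<or> v\<^sup>2 \<noteq> 0" using uv by (auto simp: zero_prod_def)
    then show "(a * v\<^sup>2 - b * u\<^sup>2, v\<^sup>2 - u\<^sup>2) \<noteq> 0"
      using assms by (auto simp: zero_prod_def left_diff_distrib[symmetric] simp del: power_eq_0_iff)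
  qed (use assms in simp)
  finally show "rat_map (proj_class ?F) (moebius_pt a b u v) = moebius_pt a b (u\<^sup>2) (v\<^sup>2)" .
qed (rule assms)

text \<open>Linear relations between the coefficients of Newton pairs survive in the limit and force
  its gcd form to be a multiple of Y^2; vanishing at [\<alpha> : \<beta>] then gives
  \<open>\<beta> = 0\<close>. Near the resulting point [Y^2 : 0] the coefficient
  \<open>- (a * b)\<close> dominates \<open>1\<close> and \<open>a + b\<close>.\<close>

lemma newton_limit_roots_bounds:
  assumes lim: "limitin (proj_topology 2) N p L" and p: "p \<in> indet_locus 2"
    and L: "L \<noteq> bot" and N: "\<forall>\<^sub>F t in L. N t \<in> newton_maps 2" and \<epsilon>: "(0::real) < \<epsilon>"
  shows "\<forall>\<^sub>F t in L. \<forall>a b. N t = proj_class (quadratic_newton_pair a b) \<longrightarrow>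
    1 < \<epsilon> * norm (a * b) \<and> norm (a + b) < \<epsilon> * norm (a * b)"
proof -
  obtain F \<alpha> \<beta> where F: "p = proj_class F" "F \<in> form_pairs 2" "hat_pair F = ([:\<alpha>:], [:\<beta>:])"
      "form_eval 2 (gcd_part F) \<alpha> \<beta> = 0"
    using p by (auto simp: indet_locus_def)
  define g where "g = gcd_part F"
  have "fst F = fst (hat_pair F) * g" "snd F = snd (hat_pair F) * g"
    by (simp_all add: hat_pair_def g_def gcd_part_def)
  then have Fg: "fst F = smult \<alpha> g" "snd F = smult \<beta> g" using F(3) by simp_all
  have F0: "F \<noteq> (0, 0)" "degree (fst F) \<le> 2" "degree (snd F) \<le> 2"
    using F(2) by (simp_all add: form_pairs_def)
  have g0: "g \<noteq> 0" "\<alpha> \<noteq> 0 \<or> \<beta> \<noteq> 0" using F0(1) Fg by (auto simp: prod_eq_iff)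
  have dg: "degree g \<le> 2" using F0(2,3) g0(2) Fg by auto
  have form: "coeff g 0 * \<beta>\<^sup>2 + coeff g 1 * \<alpha> * \<beta> + coeff g 2 * \<alpha>\<^sup>2 = 0"
    using F(4) by (simp add: form_eval_def g_def[symmetric] numeral_2_eq_2 algebra_simps)
  note ev = eventually_form_coeffs[OF lim[unfolded F(1)] F(2)]
  \<comment> \<open>The complement of \<open>C\<close> is closed, invariant under scaling and
    contains all quadratic Newton pairs; hence it contains the limit.\<close>
  have closed: "form_coeffs F \<notin> C"
    if "open C" "\<And>c p q. c \<noteq> 0 \<Longrightarrow> (p, q) \<in> C \<Longrightarrow> (\<lambda>i. c * p i, \<lambda>i. c * q i) \<in> C"
      "\<And>a b. form_coeffs (quadratic_newton_pair a b) \<notin> C" for C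
  proof
    assume "form_coeffs F \<in> C"
    have "\<forall>\<^sub>F t in L. \<forall>G. N t = proj_class G \<longrightarrow> form_coeffs G \<in> C"
      by (rule ev[OF that(1) \<open>form_coeffs F \<in> C\<close>]) (rule that(2))
    with N have "\<forall>\<^sub>F t in L. False"
      by eventually_elim (metis newton_maps_2E that(3))
    then show False using L by (simp add: eventually_False)
  qed
  have A1: "coeff (fst F) 1 = 0"
  proof -
    have "form_coeffs F \<notin> {c. fst c 1 \<noteq> 0}"
      by (rule closed, intro open_Collect_neq continuous_intros)
         (auto simp: quadratic_newton_pair_def)
    then show ?thesis by simp
  qed
  have B2: "coeff (snd F) 2 = 0"
  proof -
    have "form_coeffs F \<notin> {c. snd c 2 \<noteq> 0}"
      by (rule closed, intro open_Collect_neq continuous_intros)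
         (auto simp: quadratic_newton_pair_def numeral_2_eq_2)
    then show ?thesis by simp
  qed
  have BA: "coeff (snd F) 1 = 2 * coeff (fst F) 2"
  proof -
    have "form_coeffs F \<notin> {c. snd c 1 \<noteq> 2 * fst c 2}"
      by (rule closed, intro open_Collect_neq continuous_intros)
         (auto simp: quadratic_newton_pair_def numeral_2_eq_2)
    then show ?thesis by simp
  qed
  \<comment> \<open>If \<open>\<alpha> \<noteq> 0\<close>, then \<open>A1\<close> kills the linear
    coefficient of \<open>g\<close> and \<open>BA\<close> the quadratic one. If
    \<open>\<alpha> = 0\<close>, then \<open>\<beta> \<noteq> 0\<close>, and \<open>B2\<close> and
    \<open>BA\<close> kill both.\<close>
  have g12: "coeff g 1 = 0 \<and> coeff g 2 = 0"
    using A1 B2 BA g0(2) unfolding Fg by (cases "\<alpha> = 0") auto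
  have "g = [:coeff g 0:]"
  proof (rule poly_eqI)
    fix n
    consider "n = (0::nat)" | "n = 1" | "n = 2" | "2 < n" by linarith
    then show "coeff g n = coeff [:coeff g 0:] n"
      using g12 dg by cases (auto simp: coeff_eq_0 coeff_pCons split: nat.split)
  qed
  then have "coeff g 0 \<noteq> 0" using g0(1) by (metis pCons_0_0)
  moreover from this have "\<beta> = 0" using form g12 by simp
  ultimately have FA: "coeff (fst F) 0 \<noteq> 0" "coeff (fst F) 2 = 0" "snd F = 0"
    using g0(2) g12 unfolding Fg by auto
  let ?C = "{c :: (nat \<Rightarrow> complex) \<times> (nat \<Rightarrow> complex).
    norm (fst c 2) < \<epsilon> * norm (fst c 0)} \<inter> {c. norm (snd c 0) < \<epsilon> * norm (fst c 0)}"
  have "\<forall>\<^sub>F t in L. \<forall>G. N t = proj_class G \<longrightarrow> form_coeffs G \<in> ?C"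
  proof (rule ev)
    show "open ?C" by (intro open_Int open_Collect_less continuous_intros)
    show "form_coeffs F \<in> ?C" using FA \<epsilon> by simp
    fix c :: complex and q r :: "nat \<Rightarrow> complex"
    assume "c \<noteq> 0" "(q, r) \<in> ?C"
    then show "(\<lambda>i. c * q i, \<lambda>i. c * r i) \<in> ?C"
      using mult_strict_left_mono[of _ _ "norm c"] by (auto simp: norm_mult mult.left_commute)
  qed
  then show ?thesis
  proof (rule eventually_mono, intro allI impI)
    fix t a b
    assume G: "\<forall>G. N t = proj_class G \<longrightarrow> form_coeffs G \<in> ?C"
      and t: "N t = proj_class (quadratic_newton_pair a b)"
    from G t have "form_coeffs (quadratic_newton_pair a b) \<in> ?C" by blast
    moreover have "norm (- a - b) = norm (a + b)" by (metis minus_add_distrib norm_minus_cancel diff_conv_add_uminus)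
    ultimately show "1 < \<epsilon> * norm (a * b) \<and> norm (a + b) < \<epsilon> * norm (a * b)"
      by (simp add: quadratic_newton_pair_def numeral_2_eq_2)
  qed
qed

text \<open>The reciprocals of the roots have sum \<open>(a + b) / (a * b)\<close> and product
  \<open>1 / (a * b)\<close>. Both tend to 0, so both reciprocals do.\<close>

lemma newton_limit_roots_at_infinity:
  assumes lim: "limitin (proj_topology 2) N p L" and p: "p \<in> indet_locus 2"
    and L: "L \<noteq> bot" and N: "\<forall>\<^sub>F t in L. N t \<in> newton_maps 2"
  shows "\<forall>\<^sub>F t in L. \<forall>a b. N t = proj_class (quadratic_newton_pair a b) \<longrightarrow> R < norm b"
proof -
  define S where "S = max 1 R"
  have S: "1 \<le> S" "R \<le> S" by (simp_all add: S_def)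
  \<comment> \<open>If \<open>norm b \<le> S\<close>, then \<open>\<epsilon> * S \<le> 1 / 2\<close>
    yields \<open>norm (a + b) < norm a / 2\<close>, hence \<open>norm a < 2 * S\<close>; now
    \<open>\<epsilon> * (2 * S) * S = 1\<close> contradicts the lower bound on
    \<open>norm (a * b)\<close>.\<close>
  define \<epsilon> where "\<epsilon> = 1 / (2 * S\<^sup>2)"
  have "0 < \<epsilon>" using S by (simp add: \<epsilon>_def)
  from newton_limit_roots_bounds[OF assms this] show ?thesis
  proof (rule eventually_mono, intro allI impI)
    fix t a b
    assume "\<forall>a b. N t = proj_class (quadratic_newton_pair a b) \<longrightarrow>
        1 < \<epsilon> * norm (a * b) \<and> norm (a + b) < \<epsilon> * norm (a * b)"
      and "N t = proj_class (quadratic_newton_pair a b)"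
    then have ab: "1 < \<epsilon> * norm (a * b)" "norm (a + b) < \<epsilon> * norm (a * b)" by auto
    show "R < norm b"
    proof (rule ccontr)
      assume "\<not> R < norm b"
      then have bS: "norm b \<le> S" using S by simp
      have e1: "\<epsilon> * S \<le> 1 / 2" using S by (simp add: \<epsilon>_def power2_eq_square field_simps)
      have "\<epsilon> * norm (a * b) \<le> \<epsilon> * (norm a * S)"
        using bS \<open>0 < \<epsilon>\<close> by (simp add: norm_mult mult_left_mono)
      also have "\<dots> = norm a * (\<epsilon> * S)" by simp
      finally have e2: "\<epsilon> * norm (a * b) \<le> norm a * (\<epsilon> * S)" .
      also have "\<dots> \<le> norm a * (1 / 2)" using e1 by (rule mult_left_mono) simp
      finally have "norm (a + b) < norm a / 2" using ab(2) by simp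
      moreover have "norm a \<le> norm (a + b) + norm b" using norm_triangle_ineq4[of "a + b" b] by simp
      ultimately have "norm a < 2 * S" using bS by simp
      then have "norm a * (\<epsilon> * S) \<le> 2 * S * (\<epsilon> * S)"
        using \<open>0 < \<epsilon>\<close> S by (intro mult_right_mono) auto
      also have "\<dots> = 1" using S by (simp add: \<epsilon>_def power2_eq_square)
      finally show False using ab(1) e2 by simp
    qed
  qed
qed

section \<open>Identification of the weak limit\<close>

lemma eq_return_of_AE:
  assumes "borel_prob M" "AE x in M. x = y"
  shows "M = return borel y"
proof (rule measure_eqI)
  interpret prob_space M using assms by (simp add: borel_prob_def)
  show s: "sets M = sets (return borel y)" using assms by (simp add: borel_prob_def)
  fix A assume A: "A \<in> sets M"
  show "emeasure M A = emeasure (return borel y) A"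
  proof (cases "y \<in> A")
    case True
    have "emeasure M A = emeasure M (space M)"
      by (rule emeasure_eq_AE) (use assms(2) A True in \<open>auto elim: eventually_mono\<close>)
    then show ?thesis using True A s by (simp add: emeasure_space_1)
  next
    case False
    have "emeasure M A = emeasure M {}"
      by (rule emeasure_eq_AE) (use assms(2) A False in \<open>auto elim: eventually_mono\<close>)
    then show ?thesis using False A s by simp
  qed
qed

theorem corollary4p13:
  fixes N :: "complex \<Rightarrow> form_pair set" and p :: "form_pair set"
    and \<mu>t :: "complex \<Rightarrow> cp1 measure" and \<mu> :: "cp1 measure"
  assumes "holomorphic_newton_family 2 N"
    and "p \<in> indet_locus 2"
    and "limitin (proj_topology 2) N p (at 0)"
    and "\<And>t. t \<in> ball 0 1 - {0} \<Longrightarrow> maximal_measure (rat_map (N t)) (\<mu>t t)"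
    and "weak_limit \<mu>t \<mu> (at 0)"
  shows "\<mu> = return borel cp1_infinity"
proof -
  have N: "N t \<in> newton_maps 2" if "t \<in> ball 0 1 - {0}" for t
    using assms(1) that by (simp add: holomorphic_newton_family_def)
  have near: "\<forall>\<^sub>F t in at 0. t \<in> ball 0 1 - {0 :: complex}"
    unfolding eventually_at by (rule exI[of _ 1]) (auto simp: dist_commute)
  have evN: "\<forall>\<^sub>F t in at 0. N t \<in> newton_maps 2" using near by eventually_elim (rule N)
  have meas: "depth \<in> borel_measurable M" if "sets M = sets borel" for M :: "cp1 measure"
    using borel_measurable_continuous_onI[OF depth_continuous]
      measurable_cong_sets[OF that refl, of borel] by blast
  have small: "\<forall>\<^sub>F t in at 0. (\<integral>z. depth z \<partial>\<mu>t t) \<le> 2 * \<epsilon>" if \<epsilon>: "0 < \<epsilon>" for \<epsilon>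
  proof -
    \<comment> \<open>Order of choices: \<open>\<epsilon>\<close> fixes \<open>m\<close>,
      \<open>m\<close> fixes \<open>\<delta>\<close>, and \<open>\<epsilon>\<close> and
      \<open>\<delta>\<close> fix how large \<open>norm b\<close> must be; only then does
      \<open>t\<close> tend to 0.\<close>
    obtain m :: nat where m0: "33 / \<epsilon> < real m" using reals_Archimedean2 by blast
    have "0 < 33 / \<epsilon>" using \<epsilon> by simp
    then have "0 < real m" using m0 by (rule less_trans)
    then have m: "0 < m" "33 / real (m + 1) \<le> \<epsilon>" using m0 \<epsilon> by (simp_all add: field_simps)
    obtain \<delta> where \<delta>: "0 < \<delta>" "\<And>x y. \<bar>x - y\<bar> \<le> 1 \<Longrightarrow>
        norm (cis (2 * pi * x) - cis (2 * pi * y)) < \<delta> \<Longrightarrow>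
        \<exists>k\<in>{- 1, 0, 1}. \<bar>x - y - of_int k\<bar> < 1 / 2 ^ m"
      using chord_small[of "1 / 2 ^ m"] by auto
    show ?thesis
      using near newton_limit_roots_at_infinity[OF assms(3,2) _ evN, of "4 / \<epsilon> / \<delta>"]
    proof (rule eventually_elim2)
      fix t
      assume t: "t \<in> ball 0 1 - {0}"
        and far: "\<forall>a b. N t = proj_class (quadratic_newton_pair a b) \<longrightarrow> 4 / \<epsilon> / \<delta> < norm b"
      obtain a b where ab: "a \<noteq> b" "N t = proj_class (quadratic_newton_pair a b)"
        using newton_maps_2E[OF N[OF t]] .
      interpret quadratic_newton a b "rat_map (N t)"
        unfolding ab(2) by (rule quadratic_newton_rat_map[OF ab(1)])
      have max: "maximal_measure (rat_map (N t)) (\<mu>t t)" by (rule assms(4)[OF t])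
      then have M: "prob_space (\<mu>t t)" "sets (\<mu>t t) = sets borel"
        by (simp_all add: maximal_measure_def invariant_prob_def borel_prob_def)
      interpret M: prob_space "\<mu>t t" by fact
      have sp: "space (\<mu>t t) = UNIV" using sets_eq_imp_space_eq[OF M(2)] by simp
      have "4 / \<epsilon> / \<delta> < norm b" using far ab(2) by blast
      then have "4 / \<epsilon> < \<delta> * norm b"
        using \<delta>(1) by (simp only: pos_divide_less_eq mult.commute)
      then have D: "measure (\<mu>t t) {z. \<epsilon> < depth z} \<le> \<epsilon>"
        by (intro order.trans[OF maximal_measure_depth_le[OF max m(1) \<epsilon>] m(2)] \<delta>(2))
      have sD: "{z. \<epsilon> < depth z} \<in> sets (\<mu>t t)"
        using borel_measurable_less[OF borel_measurable_const meas[OF M(2)], of \<epsilon>] by (simp add: sp)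
      \<comment> \<open>Off the set where it exceeds \<open>\<epsilon>\<close>, \<open>depth\<close>
        contributes at most \<open>\<epsilon>\<close>; on that set it is at most 1, so the mass
        bound \<open>D\<close> applies.\<close>
      have "(\<integral>z. depth z \<partial>\<mu>t t) \<le> (\<integral>z. \<epsilon> + indicator {z. \<epsilon> < depth z} z \<partial>\<mu>t t)"
      proof (rule integral_mono)
        show "integrable (\<mu>t t) depth"
          by (rule M.integrable_const_bound[of _ 1]) (use meas[OF M(2)] depth_bounds in auto)
        show "integrable (\<mu>t t) (\<lambda>z. \<epsilon> + indicator {z. \<epsilon> < depth z} z)"
          using sD by (intro Bochner_Integration.integrable_add) (auto simp: M.emeasure_eq_measure)
        show "depth z \<le> \<epsilon> + indicator {z. \<epsilon> < depth z} z" for z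
          using depth_bounds[of z] \<epsilon> by (auto simp: indicator_def)
      qed
      also have "\<dots> = \<epsilon> + measure (\<mu>t t) {z. \<epsilon> < depth z}"
        using sD M.prob_space
        by (subst Bochner_Integration.integral_add) (auto simp: M.emeasure_eq_measure sp)
      finally show "(\<integral>z. depth z \<partial>\<mu>t t) \<le> 2 * \<epsilon>" using D by simp
    qed simp
  qed
  have \<mu>: "borel_prob \<mu>" and
    conv: "((\<lambda>t. \<integral>z. depth z \<partial>\<mu>t t) \<longlongrightarrow> (\<integral>z. depth z \<partial>\<mu>)) (at 0)"
    using assms(5) depth_continuous depth_bounds
    by (auto simp: weak_limit_def bounded_iff intro!: exI[of _ 1])
  interpret prob_space \<mu> using \<mu> by (simp add: borel_prob_def)
  have int: "integrable \<mu> depth"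
    by (rule integrable_const_bound[of _ 1]) (use meas \<mu> depth_bounds in \<open>auto simp: borel_prob_def\<close>)
  have "(\<integral>z. depth z \<partial>\<mu>) \<le> 0"
  proof (rule field_le_epsilon)
    fix e :: real assume "0 < e"
    then have "(\<integral>z. depth z \<partial>\<mu>) \<le> 2 * (e / 2)"
      by (intro tendsto_upperbound[OF conv small]) auto
    then show "(\<integral>z. depth z \<partial>\<mu>) \<le> 0 + e" by simp
  qed
  moreover have "0 \<le> (\<integral>z. depth z \<partial>\<mu>)" by (intro Bochner_Integration.integral_nonneg depth_bounds)
  ultimately have "(\<integral>z. depth z \<partial>\<mu>) = 0" by (rule antisym)
  then have "AE z in \<mu>. depth z = 0"
    using integral_nonneg_eq_0_iff_AE[OF int] depth_bounds by simp
  then show ?thesis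
    by (intro eq_return_of_AE[OF \<mu>]) (simp add: depth_eq_0_iff)
qed

end
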